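(* Let $(X,\mu,T)$ be a measure-preserving $G$-system, where $G$ is the free group of rank $r$, and let $\beta\colon X\to B$ be a finite observable. For each $n$ let $\mathbf y_n\in B^n$ and $\sigma_n\in\mathrm{Hom}(G,\mathrm{Sym}(n))$. Suppose that one of the following holds: (a) $\beta^G_*\mu$ is a Markov measure, $\lim_{n\to\infty}d_0^*(P^{\sigma_n}_{\mathbf y_n},\beta^G_*\mu)=0$, and $\mu_n=\mathrm{SBM}(\sigma_n,\mathbf y_n,0)$ for all $n$; or (b) $f_\mu(T,\beta)>-\infty$, $(m_n)$ is a sequence in $\mathbb N$ with $m_n\to\infty$ and $m_n=o(\log\log n)$, $d_{m_n}^*(P^{\sigma_n}_{\mathbf y_n},\beta^G_*\mu)=O(\frac1{\log n})$, and $\mu_n=\mathrm{SBM}(\sigma_n,\mathbf y_n,m_n)$ for all $n$. Then for any finite $D\subset G$ and any $\delta>0$ there exists $\varepsilon>0$ such that $$\mathbb P_{\sigma\sim\mu_n}\big(\sigma\text{ is }(D,\delta)\text{-sofic}\big)\ge 1-n^{-\varepsilon n}$$ for all large enough $n$.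
   Context: $G$ is the free group of rank $r\ge1$ with free generators $s_1,\dots,s_r$, identity $e$ and word length $|\cdot|$; $B(g,k)=\{hg: h\in G,\ |h|\le k\}$ is the closed ball of radius $k$ about $g$; $\mathbb N$ includes $0$; $[n]=\{1,\dots,n\}$. $(X,\mu)$ is a standard probability space and $T$ is a homomorphism from $G$ to its group of measure-preserving automorphisms. A finite observable is a measurable map $\beta\colon X\to B$ to a finite set $B$. For $H\subseteq G$, $\beta^H\colon X\to B^H$ is $(\beta^H(x))_g=\beta(T_gx)$; $\beta^k:=\beta^{B(e,k)}$. A homomorphism $\sigma\in\mathrm{Hom}(G,\mathrm{Sym}(n))$ is $(D,\delta)$-sofic if $|\{j\in[n]:\sigma(\gamma)j\ne j\ \ \forall\gamma\in D\setminus\{e\}\}|>(1-\delta)n$. For $\sigma\in\mathrm{Hom}(G,\mathrm{Sym}(n))$ and $\mathbf y\in B^n$, define $\mathbf y^G\colon[n]\to B^G$ by $(\mathbf y^G(j))_g=\mathbf y(\sigma(g)j)$, and $P^\sigma_{\mathbf y}=(\mathbf y^G)_*\mathrm{Unif}(n)\in\mathrm{Prob}(B^G)$. For finite $H\subset G$, $d^H(\nu,\nu')$ is the total variation distance ($\frac12$ of the $\ell^1$ distance) between the marginals of $\nu,\nu'\in\mathrm{Prob}(B^G)$ on $B^H$, and $d_k^*(\nu,\nu')=\sum_{i=1}^rd^{B(e,k)\cup B(s_i,k)}(\nu,\nu')$. $\mathrm{SBM}(\sigma_0,\mathbf y_0,k)=\mathrm{Unif}\{\sigma\in\mathrm{Hom}(G,\mathrm{Sym}(n))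 : d_k^*(P^\sigma_{\mathbf y_0},P^{\sigma_0}_{\mathbf y_0})=0\}$ for $\sigma_0\in\mathrm{Hom}(G,\mathrm{Sym}(n))$, $\mathbf y_0\in B^n$, $k\in\mathbb N$. Shannon entropy: $\mathrm H_\mu(\beta)=-\sum_b\beta_*\mu(b)\log\beta_*\mu(b)$. $F_\mu(T,\beta)=(1-2r)\mathrm H_\mu(\beta)+\sum_{i=1}^r\mathrm H_\mu(\beta^{\{e,s_i\}})$ and $f_\mu(T,\beta)=\inf_kF_\mu(T,\beta^k)$. Markov measure: consider the tree on $G$ with edges $\{g,s_ig\}$ ($g\in G$, $i\in[r]$). A probability measure $\nu$ on $B^G$ invariant under the shift $(S_hz)_g=z_{gh}$ is Markov if for every edge $\{g,h\}$ of this tree, under $\nu$ the coordinates $(z_u)$ with $u$ in the component containing $h$ after deleting the edge $\{g,h\}$ are conditionally independent of the coordinates in the component containing $g$, given $z_g$. *)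

theory Defs
  imports
    "HOL-Probability.Probability"
    "HOL-Library.Landau_Symbols"
    "HOL-Algebra.Sym_Groups"
    "HOL-Algebra.Bij"
begin

section \<open>Free groups\<close>

text \<open>A word is a list of letters; \<open>(i, True)\<close> stands for the generator \<open>s i\<close> and
  \<open>(i, False)\<close> for its inverse.\<close>

definition words :: "nat \<Rightarrow> (nat \<times> bool) list set" where
  "words r = lists ({1..r} \<times> UNIV)"

definition reduced_words :: "nat \<Rightarrow> (nat \<times> bool) list set" where
  "reduced_words r =
    {w \<in> words r. successively (\<lambda>(i, a) (j, b). \<not> (i = j \<and> a \<noteq> b)) w}"

definition letter_val :: "('g, 'm) monoid_scheme \<Rightarrow> (nat \<Rightarrow> 'g) \<Rightarrow> nat \<times> bool \<Rightarrow> 'g" where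
  "letter_val G s = (\<lambda>(i, a). if a then s i else inv\<^bsub>G\<^esub> (s i))"

definition word_val :: "('g, 'm) monoid_scheme \<Rightarrow> (nat \<Rightarrow> 'g) \<Rightarrow> (nat \<times> bool) list \<Rightarrow> 'g" where
  "word_val G s w = foldr (\<lambda>l g. letter_val G s l \<otimes>\<^bsub>G\<^esub> g) w \<one>\<^bsub>G\<^esub>"

text \<open>\<open>G\<close> is free with free generators \<open>s 1, \<dots>, s r\<close>: every element is the value of
  exactly one reduced word.\<close>

definition free_group :: "('g, 'm) monoid_scheme \<Rightarrow> (nat \<Rightarrow> 'g) \<Rightarrow> nat \<Rightarrow> bool" where
  "free_group G s r \<longleftrightarrow>
    group G \<and> s ` {1..r} \<subseteq> carrier G \<and>
    bij_betw (word_val G s) (reduced_words r) (carrier G)"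

definition word_length :: "('g, 'm) monoid_scheme \<Rightarrow> (nat \<Rightarrow> 'g) \<Rightarrow> nat \<Rightarrow> 'g \<Rightarrow> nat" where
  "word_length G s r g = (LEAST l. \<exists>w \<in> words r. length w = l \<and> word_val G s w = g)"

definition word_ball :: "('g, 'm) monoid_scheme \<Rightarrow> (nat \<Rightarrow> 'g) \<Rightarrow> nat \<Rightarrow> 'g \<Rightarrow> nat \<Rightarrow> 'g set" where
  "word_ball G s r g k = {h \<otimes>\<^bsub>G\<^esub> g | h. h \<in> carrier G \<and> word_length G s r h \<le> k}"


section \<open>Permutation actions\<close>

text \<open>Homomorphisms are taken extensional, so that distinct functions are distinct
  homomorphisms and the set is finite for finitely generated \<open>G\<close>.\<close>

definition Hom_Sym :: "('g, 'm) monoid_scheme \<Rightarrow> nat \<Rightarrow> ('g \<Rightarrow> nat \<Rightarrow> nat) set" where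
  "Hom_Sym G n = hom G (sym_group n) \<inter> extensional (carrier G)"

definition sofic ::
  "('g, 'm) monoid_scheme \<Rightarrow> 'g set \<Rightarrow> real \<Rightarrow> nat \<Rightarrow> ('g \<Rightarrow> nat \<Rightarrow> nat) \<Rightarrow> bool" where
  "sofic G D \<delta> n \<sigma> \<longleftrightarrow>
    real (card {j \<in> {1..n}. \<forall>\<gamma> \<in> D - {\<one>\<^bsub>G\<^esub>}. \<sigma> \<gamma> j \<noteq> j}) > (1 - \<delta>) * real n"


section \<open>Measure-preserving systems\<close>

definition standard_borel :: "'x measure \<Rightarrow> bool" where
  "standard_borel M \<longleftrightarrow>
    (\<exists>X. topspace X = space M \<and> completely_metrizable_space X \<and> second_countable X \<and>
         sets M = sigma_sets (space M) {U. openin X U})"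

text \<open>Both usual conventions are admitted: a Borel probability measure on a standard Borel
  space, or the completion of one.\<close>

definition standard_prob_space :: "'x measure \<Rightarrow> bool" where
  "standard_prob_space M \<longleftrightarrow>
    prob_space M \<and> (standard_borel M \<or> (\<exists>N. standard_borel N \<and> M = completion N))"

definition mp_automorphisms :: "'x measure \<Rightarrow> ('x \<Rightarrow> 'x) set" where
  "mp_automorphisms M =
    {f \<in> Bij (space M). f \<in> M \<rightarrow>\<^sub>M M \<and> inv_into (space M) f \<in> M \<rightarrow>\<^sub>M M \<and> distr M M f = M}"

definition mp_aut_group :: "'x measure \<Rightarrow> ('x \<Rightarrow> 'x) monoid" where
  "mp_aut_group M = (BijGroup (space M)) \<lparr>carrier := mp_automorphisms M\<rparr>"

text \<open>The observable \<open>\<beta>\<^sup>H\<close>.\<close>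

definition obs_pow :: "('g \<Rightarrow> 'x \<Rightarrow> 'x) \<Rightarrow> ('x \<Rightarrow> 'b) \<Rightarrow> 'g set \<Rightarrow> 'x \<Rightarrow> 'g \<Rightarrow> 'b" where
  "obs_pow T \<beta> H x = (\<lambda>g\<in>H. \<beta> (T g x))"


section \<open>Measures on the full shift\<close>

definition config_space :: "'g set \<Rightarrow> 'b set \<Rightarrow> ('g \<Rightarrow> 'b) measure" where
  "config_space H B = (\<Pi>\<^sub>M g\<in>H. count_space B)"

definition obs_law ::
  "('g, 'm) monoid_scheme \<Rightarrow> 'x measure \<Rightarrow> ('g \<Rightarrow> 'x \<Rightarrow> 'x) \<Rightarrow> 'b set \<Rightarrow> ('x \<Rightarrow> 'b) \<Rightarrow>
    ('g \<Rightarrow> 'b) measure" where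
  "obs_law G M T B \<beta> = distr M (config_space (carrier G) B) (obs_pow T \<beta> (carrier G))"

definition empirical_law ::
  "('g, 'm) monoid_scheme \<Rightarrow> 'b set \<Rightarrow> nat \<Rightarrow> ('g \<Rightarrow> nat \<Rightarrow> nat) \<Rightarrow> (nat \<Rightarrow> 'b) \<Rightarrow>
    ('g \<Rightarrow> 'b) measure" where
  "empirical_law G B n \<sigma> y =
    distr (uniform_count_measure {1..n}) (config_space (carrier G) B)
      (\<lambda>j. \<lambda>g\<in>carrier G. y (\<sigma> g j))"

definition marginal ::
  "'b set \<Rightarrow> 'g set \<Rightarrow> ('g \<Rightarrow> 'b) measure \<Rightarrow> ('g \<Rightarrow> 'b) measure" where
  "marginal B H \<nu> = distr \<nu> (config_space H B) (\<lambda>z. restrict z H)"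

definition marginal_tv ::
  "'b set \<Rightarrow> 'g set \<Rightarrow> ('g \<Rightarrow> 'b) measure \<Rightarrow> ('g \<Rightarrow> 'b) measure \<Rightarrow> real" where
  "marginal_tv B H \<nu> \<nu>' =
    (1/2) * (\<Sum>a \<in> H \<rightarrow>\<^sub>E B. \<bar>measure (marginal B H \<nu>) {a} - measure (marginal B H \<nu>') {a}\<bar>)"

definition d_star ::
  "('g, 'm) monoid_scheme \<Rightarrow> (nat \<Rightarrow> 'g) \<Rightarrow> nat \<Rightarrow> 'b set \<Rightarrow> nat \<Rightarrow>
    ('g \<Rightarrow> 'b) measure \<Rightarrow> ('g \<Rightarrow> 'b) measure \<Rightarrow> real" where
  "d_star G s r B k \<nu> \<nu>' =
    (\<Sum>i = 1..r. marginal_tv B (word_ball G s r \<one>\<^bsub>G\<^esub> k \<union> word_ball G s r (s i) k) \<nu> \<nu>')"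

definition SBM_support ::
  "('g, 'm) monoid_scheme \<Rightarrow> (nat \<Rightarrow> 'g) \<Rightarrow> nat \<Rightarrow> 'b set \<Rightarrow> nat \<Rightarrow>
    ('g \<Rightarrow> nat \<Rightarrow> nat) \<Rightarrow> (nat \<Rightarrow> 'b) \<Rightarrow> nat \<Rightarrow> ('g \<Rightarrow> nat \<Rightarrow> nat) set" where
  "SBM_support G s r B n \<sigma>0 y0 k =
    {\<sigma> \<in> Hom_Sym G n.
      d_star G s r B k (empirical_law G B n \<sigma> y0) (empirical_law G B n \<sigma>0 y0) = 0}"

definition SBM ::
  "('g, 'm) monoid_scheme \<Rightarrow> (nat \<Rightarrow> 'g) \<Rightarrow> nat \<Rightarrow> 'b set \<Rightarrow> nat \<Rightarrow>
    ('g \<Rightarrow> nat \<Rightarrow> nat) \<Rightarrow> (nat \<Rightarrow> 'b) \<Rightarrow> nat \<Rightarrow> ('g \<Rightarrow> nat \<Rightarrow> nat) pmf" where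
  "SBM G s r B n \<sigma>0 y0 k = pmf_of_set (SBM_support G s r B n \<sigma>0 y0 k)"


section \<open>Entropy and the f-invariant\<close>

definition shannon :: "'x measure \<Rightarrow> 'c set \<Rightarrow> ('x \<Rightarrow> 'c) \<Rightarrow> real" where
  "shannon M C \<alpha> =
    - (\<Sum>c\<in>C. measure (distr M (count_space C) \<alpha>) {c} *
              ln (measure (distr M (count_space C) \<alpha>) {c}))"

text \<open>\<open>C\<close> is the finite target set of the observable \<open>\<alpha>\<close>.\<close>

definition F_functional ::
  "('g, 'm) monoid_scheme \<Rightarrow> (nat \<Rightarrow> 'g) \<Rightarrow> nat \<Rightarrow> 'x measure \<Rightarrow> ('g \<Rightarrow> 'x \<Rightarrow> 'x) \<Rightarrow>
    'c set \<Rightarrow> ('x \<Rightarrow> 'c) \<Rightarrow> real" where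
  "F_functional G s r M T C \<alpha> =
    (1 - 2 * real r) * shannon M C \<alpha> +
    (\<Sum>i = 1..r. shannon M ({\<one>\<^bsub>G\<^esub>, s i} \<rightarrow>\<^sub>E C) (obs_pow T \<alpha> {\<one>\<^bsub>G\<^esub>, s i}))"

definition f_invariant ::
  "('g, 'm) monoid_scheme \<Rightarrow> (nat \<Rightarrow> 'g) \<Rightarrow> nat \<Rightarrow> 'x measure \<Rightarrow> ('g \<Rightarrow> 'x \<Rightarrow> 'x) \<Rightarrow>
    'b set \<Rightarrow> ('x \<Rightarrow> 'b) \<Rightarrow> ereal" where
  "f_invariant G s r M T B \<beta> =
    (INF k :: nat. ereal (F_functional G s r M T
      (word_ball G s r \<one>\<^bsub>G\<^esub> k \<rightarrow>\<^sub>E B) (obs_pow T \<beta> (word_ball G s r \<one>\<^bsub>G\<^esub> k))))"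


section \<open>Markov measures\<close>

text \<open>The edge set is symmetric: each undirected edge occurs in both orientations.\<close>

definition tree_edges :: "('g, 'm) monoid_scheme \<Rightarrow> (nat \<Rightarrow> 'g) \<Rightarrow> nat \<Rightarrow> ('g \<times> 'g) set" where
  "tree_edges G s r =
    {(g, h). g \<in> carrier G \<and> h \<in> carrier G \<and>
      (\<exists>i \<in> {1..r}. h = s i \<otimes>\<^bsub>G\<^esub> g \<or> g = s i \<otimes>\<^bsub>G\<^esub> h)}"

text \<open>The component containing \<open>u\<close> after deleting the undirected edge \<open>{g, h}\<close>.\<close>

definition component_without ::
  "('g \<times> 'g) set \<Rightarrow> 'g \<Rightarrow> 'g \<Rightarrow> 'g \<Rightarrow> 'g set" where
  "component_without E g h u = {v. (u, v) \<in> (E - {(g, h), (h, g)})\<^sup>*}"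

definition shift :: "('g, 'm) monoid_scheme \<Rightarrow> 'g \<Rightarrow> ('g \<Rightarrow> 'b) \<Rightarrow> 'g \<Rightarrow> 'b" where
  "shift G h z = (\<lambda>g\<in>carrier G. z (g \<otimes>\<^bsub>G\<^esub> h))"

text \<open>As the conditioning variable is finite-valued, conditional independence given it means
  independence under each conditional measure \<open>\<nu>(\<cdot> | z g = b)\<close> with \<open>\<nu>(z g = b) > 0\<close>;
  \<open>uniform_measure \<nu> A\<close> is \<open>\<nu>\<close> conditioned on the event \<open>A\<close>.\<close>

definition markov_measure ::
  "('g, 'm) monoid_scheme \<Rightarrow> (nat \<Rightarrow> 'g) \<Rightarrow> nat \<Rightarrow> 'b set \<Rightarrow> ('g \<Rightarrow> 'b) measure \<Rightarrow> bool" where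
  "markov_measure G s r B \<nu> \<longleftrightarrow>
    prob_space \<nu> \<and> sets \<nu> = sets (config_space (carrier G) B) \<and>
    (\<forall>h \<in> carrier G. distr \<nu> \<nu> (shift G h) = \<nu>) \<and>
    (\<forall>(g, h) \<in> tree_edges G s r. \<forall>b \<in> B.
      let A = {z \<in> space \<nu>. z g = b};
          C\<^sub>h = component_without (tree_edges G s r) g h h;
          C\<^sub>g = component_without (tree_edges G s r) g h g
      in measure \<nu> A > 0 \<longrightarrow>
         prob_space.indep_var (uniform_measure \<nu> A)
           (config_space C\<^sub>h B) (\<lambda>z. restrict z C\<^sub>h)
           (config_space C\<^sub>g B) (\<lambda>z. restrict z C\<^sub>g))"


section \<open>Well-definedness of the stochastic block model\<close>

lemma word_val_closed:
  assumes "group G" "s ` {1..r} \<subseteq> carrier G" "w \<in> words r"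
  shows "word_val G s w \<in> carrier G"
  using assms(3)
proof (induction w)
  case Nil
  then show ?case using assms(1) by (simp add: word_val_def group.is_monoid)
next
  case (Cons l w)
  interpret group G by fact
  show ?case using Cons assms(2)
    by (auto simp: word_val_def words_def letter_val_def split: prod.splits)
qed

lemma Hom_Sym_eqI:
  assumes G: "free_group G s r" and \<sigma>: "\<sigma> \<in> Hom_Sym G n" and \<tau>: "\<tau> \<in> Hom_Sym G n"
    and eq: "\<And>i. i \<in> {1..r} \<Longrightarrow> \<sigma> (s i) = \<tau> (s i)"
  shows "\<sigma> = \<tau>"
proof -
  interpret group G using G by (simp add: free_group_def)
  interpret \<sigma>: group_hom G "sym_group n" \<sigma>
    using \<sigma> group_axioms sym_group_is_group
    by (simp add: Hom_Sym_def group_hom_def group_hom_axioms_def)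
  interpret \<tau>: group_hom G "sym_group n" \<tau>
    using \<tau> group_axioms sym_group_is_group
    by (simp add: Hom_Sym_def group_hom_def group_hom_axioms_def)
  have s: "s ` {1..r} \<subseteq> carrier G" using G by (simp add: free_group_def)
  have *: "\<sigma> (word_val G s w) = \<tau> (word_val G s w)" if "w \<in> words r" for w
    using that
  proof (induction w)
    case Nil
    then show ?case by (simp add: word_val_def)
  next
    case (Cons l w)
    obtain i a where l: "l = (i, a)" by (cases l)
    have w: "w \<in> words r" and i: "i \<in> {1..r}" using Cons.prems l by (auto simp: words_def)
    have si: "s i \<in> carrier G" using s i by auto
    have lv: "letter_val G s l \<in> carrier G" "\<sigma> (letter_val G s l) = \<tau> (letter_val G s l)"
      using si eq[OF i] by (auto simp: l letter_val_def)
    have "word_val G s (l # w) = letter_val G s l \<otimes>\<^bsub>G\<^esub> word_val G s w"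
      by (simp add: word_val_def)
    then show ?case
      using lv Cons.IH[OF w] word_val_closed[OF is_group s w] by simp
  qed
  show ?thesis
  proof (rule extensionalityI)
    show "\<sigma> \<in> extensional (carrier G)" "\<tau> \<in> extensional (carrier G)"
      using \<sigma> \<tau> by (auto simp: Hom_Sym_def)
    fix g assume "g \<in> carrier G"
    then have "g \<in> word_val G s ` reduced_words r"
      using G by (simp add: free_group_def bij_betw_def)
    then obtain w where "w \<in> reduced_words r" "g = word_val G s w"
      by blast
    then show "\<sigma> g = \<tau> g" using * by (auto simp: reduced_words_def)
  qed
qed

lemma finite_Hom_Sym:
  assumes "free_group G s r"
  shows "finite (Hom_Sym G n)"
proof (rule inj_on_finite)
  show "inj_on (\<lambda>\<sigma>. \<lambda>i\<in>{1..r}. \<sigma> (s i)) (Hom_Sym G n)"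
  proof (rule inj_onI)
    fix \<sigma> \<tau> assume h: "\<sigma> \<in> Hom_Sym G n" "\<tau> \<in> Hom_Sym G n"
      and e: "(\<lambda>i\<in>{1..r}. \<sigma> (s i)) = (\<lambda>i\<in>{1..r}. \<tau> (s i))"
    have "\<sigma> (s i) = \<tau> (s i)" if "i \<in> {1..r}" for i
      using fun_cong[OF e, of i] that by simp
    then show "\<sigma> = \<tau>" by (rule Hom_Sym_eqI[OF assms h])
  qed
  show "(\<lambda>\<sigma>. \<lambda>i\<in>{1..r}. \<sigma> (s i)) ` Hom_Sym G n \<subseteq> {1..r} \<rightarrow>\<^sub>E {p. p permutes {1..n}}"
    using assms by (fastforce simp: Hom_Sym_def free_group_def hom_def sym_group_def)
  show "finite ({1..r} \<rightarrow>\<^sub>E {p. p permutes {1..n}})"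
    by (intro finite_PiE finite_permutations) auto
qed

lemma set_pmf_SBM:
  assumes "free_group G s r" "\<sigma>0 \<in> Hom_Sym G n"
  shows "set_pmf (SBM G s r B n \<sigma>0 y0 k) = SBM_support G s r B n \<sigma>0 y0 k"
proof -
  have "\<sigma>0 \<in> SBM_support G s r B n \<sigma>0 y0 k"
    using assms(2) by (simp add: SBM_support_def d_star_def marginal_tv_def)
  moreover have "finite (SBM_support G s r B n \<sigma>0 y0 k)"
    using finite_Hom_Sym[OF assms(1)] by (simp add: SBM_support_def)
  ultimately show ?thesis unfolding SBM_def by (intro set_pmf_of_set) auto
qed

end

theory Submission
  imports Defs "HOL-Real_Asymp.Real_Asymp"
begin

text \<open>
  The proof compares two counts inside \<open>Hom(G, Sym(n))\<close>, which by freeness is the set of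
  \<open>r\<close>-tuples of permutations and so has \<open>n!^r\<close> elements.

  Few homomorphisms fail to be sofic. If \<open>\<sigma>\<close> fails, then some \<open>\<gamma> \<in> D - {e}\<close>, written as a
  reduced word, fixes a positive fraction of the points. The closed path that the word traces
  from a fixed point contains a shortest nonempty closed piece. That piece is a simple cycle in
  the Schreier graph of \<open>\<sigma>\<close> and is traced by a subword \<open>m\<close> that is the same for many fixed
  points (\<open>fixed_point_simple_closed\<close>). A positive fraction of the cycles can be chosen so that
  the inner vertices of each avoid all chosen starting points (\<open>independent_subset\<close>). Now delete
  from the graph the first edge of every chosen cycle: each deleted edge can be recovered by
  following the rest of its cycle backwards from the starting point, so \<open>\<sigma>\<close> is determined by
  what remains (\<open>isolated_roots_determined\<close>). Reconnecting \<open>t\<close> deleted edges in all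
  ways would give \<open>t!\<close> different tuples, and there are at most \<open>2^n\<close> sets of starting points.
  Hence at most \<open>C 2^n n!^r / t!\<close> homomorphisms fail, where \<open>t\<close> is about \<open>c n\<close>
  (\<open>card_not_sofic\<close>).

  The support of the block model is large. If \<open>\<tau> i\<close> is a permutation that preserves the
  \<open>\<sigma>0\<close>-pattern of \<open>y\<close> on the window \<open>B(e,k) \<union> B(s i,k)\<close> at every point, then replacing each
  \<open>\<sigma>0 (s i)\<close> by \<open>\<sigma>0 (s i) \<circ> \<tau> i\<close> changes none of these patterns (\<open>pattern_invariant\<close>). By
  pigeonhole such permutations number at least \<open>n! / N^n\<close>, where \<open>N\<close> is the number of patterns
  (\<open>card_pattern_stabiliser\<close>), so the support has at least \<open>n!^r / N^(n r)\<close> elements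
  (\<open>card_SBM_support\<close>).

  The quotient of the two counts bounds the probability of failure by
  \<open>C 2^n N^(n r) / t!\<close>. Here \<open>log N\<close> is at most a constant times \<open>(2 r + 1)^k\<close>. In both cases
  of the theorem, with \<open>k = 0\<close> and with \<open>k = o(log log n)\<close>, this is \<open>O(sqrt (log n))\<close>, and
  \<open>t!\<close> wins because \<open>log t!\<close> is of order \<open>n log n\<close>.
\<close>

section \<open>Words acting by tuples of permutations\<close>

definition letter_inv :: "nat \<times> bool \<Rightarrow> nat \<times> bool" where
  "letter_inv l = (fst l, \<not> snd l)"

text \<open>\<open>p\<close> lists the permutations by which the generators act; a word acts with its last letter first,
  as \<open>word_val\<close> and composition in \<open>sym_group\<close> prescribe.\<close>

definition letter_act :: "(nat \<Rightarrow> nat \<Rightarrow> nat) \<Rightarrow> nat \<times> bool \<Rightarrow> nat \<Rightarrow> nat" where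
  "letter_act p l = (if snd l then p (fst l) else inv' (p (fst l)))"

definition word_act :: "(nat \<Rightarrow> nat \<Rightarrow> nat) \<Rightarrow> (nat \<times> bool) list \<Rightarrow> nat \<Rightarrow> nat" where
  "word_act p w x = foldr (letter_act p) w x"

text \<open>Extensional, so that distinct elements are distinct actions of the generators.\<close>

definition perm_tuples :: "nat \<Rightarrow> nat \<Rightarrow> (nat \<Rightarrow> nat \<Rightarrow> nat) set" where
  "perm_tuples r n = {1..r} \<rightarrow>\<^sub>E {q. q permutes {1..n}}"

lemma letter_inv_simps [simp]:
  "fst (letter_inv l) = fst l" "snd (letter_inv l) = (\<not> snd l)" "letter_inv (letter_inv l) = l"
  "letter_inv l \<noteq> l"
  by (auto simp: letter_inv_def prod_eq_iff)

lemma word_act_simps [simp]: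
  "word_act p [] x = x" "word_act p (l # w) x = letter_act p l (word_act p w x)"
  by (simp_all add: word_act_def)

lemma word_act_append [simp]: "word_act p (u @ v) x = word_act p u (word_act p v x)"
  by (simp add: word_act_def)

lemma words_simps [simp]:
  "[] \<in> words r" "l # w \<in> words r \<longleftrightarrow> fst l \<in> {1..r} \<and> w \<in> words r"
  "u @ v \<in> words r \<longleftrightarrow> u \<in> words r \<and> v \<in> words r"
  by (auto simp: words_def mem_Times_iff)

lemma words_take_drop: "w \<in> words r \<Longrightarrow> take k w \<in> words r \<and> drop k w \<in> words r"
  by (metis append_take_drop_id words_simps(3))

lemma words_nth: "w \<in> words r \<Longrightarrow> k < length w \<Longrightarrow> fst (w ! k) \<in> {1..r}"
  by (metis id_take_nth_drop words_simps(2,3))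

lemma perm_tuples_permutes: "p \<in> perm_tuples r n \<Longrightarrow> i \<in> {1..r} \<Longrightarrow> p i permutes {1..n}"
  by (auto simp: perm_tuples_def)

lemma finite_perm_tuples: "finite (perm_tuples r n)"
  by (auto simp: perm_tuples_def intro!: finite_PiE finite_permutations)

lemma card_perm_tuples: "card (perm_tuples r n) = fact n ^ r"
  unfolding perm_tuples_def by (subst card_PiE) (simp_all add: card_permutations)

lemma letter_act_permutes:
  "p \<in> perm_tuples r n \<Longrightarrow> fst l \<in> {1..r} \<Longrightarrow> letter_act p l permutes {1..n}"
  unfolding letter_act_def by (metis perm_tuples_permutes permutes_inv)

lemma word_act_permutes:
  assumes "p \<in> perm_tuples r n" "w \<in> words r"
  shows "word_act p w permutes {1..n}"
  using assms(2)
proof (induction w)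
  case Nil
  have "word_act p [] = id" by auto
  then show ?case using permutes_id by metis
next
  case (Cons l w)
  have "word_act p (l # w) = letter_act p l \<circ> word_act p w" by auto
  moreover have "letter_act p l permutes {1..n}" "word_act p w permutes {1..n}"
    using Cons assms(1) letter_act_permutes by auto
  ultimately show ?case by (metis permutes_compose)
qed

lemma letter_act_inv_cancel:
  assumes "p \<in> perm_tuples r n" "fst l \<in> {1..r}"
  shows "letter_act p (letter_inv l) (letter_act p l x) = x"
    and "letter_act p l (letter_act p (letter_inv l) x) = x"
  using permutes_inverses[OF perm_tuples_permutes[OF assms]]
  by (auto simp: letter_act_def)

lemma reduced_words_no_cancel:
  assumes "w \<in> reduced_words r" "Suc k < length w"
  shows "w ! k \<noteq> letter_inv (w ! Suc k)"
proof -
  have "successively (\<lambda>(i, a) (j, b). \<not> (i = j \<and> a \<noteq> b)) w"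
    using assms(1) by (simp add: reduced_words_def)
  then have "(\<lambda>(i, a) (j, b). \<not> (i = j \<and> a \<noteq> b)) (w ! k) (w ! Suc k)"
    using assms(2) by (simp add: successively_conv_nth)
  then show ?thesis by (auto simp: letter_inv_def)
qed

section \<open>Counting actions in which a word has many fixed points\<close>

text \<open>The path traced by \<open>m\<close> from \<open>z\<close> visits the points \<open>word_act p (drop k m) z\<close>, with \<open>k\<close>
  decreasing from \<open>length m\<close> to \<open>0\<close>.\<close>

definition simple_closed :: "(nat \<Rightarrow> nat \<Rightarrow> nat) \<Rightarrow> (nat \<times> bool) list \<Rightarrow> nat \<Rightarrow> bool" where
  "simple_closed p m z \<longleftrightarrow>
    word_act p m z = z \<and> (\<forall>k. 0 < k \<and> k < length m \<longrightarrow> word_act p (drop k m) z \<noteq> z)"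

text \<open>The step along the last letter is the first one on the path. For a closed path,
  the condition says that the final step does not run back along the same edge of the graph.\<close>

definition cyc_reduced_ends :: "(nat \<times> bool) list \<Rightarrow> bool" where
  "cyc_reduced_ends m \<longleftrightarrow> m \<noteq> [] \<and> hd m \<noteq> letter_inv (last m)"

abbreviation subword :: "(nat \<times> bool) list \<Rightarrow> nat \<Rightarrow> nat \<Rightarrow> (nat \<times> bool) list" where
  "subword w a d \<equiv> take d (drop a w)"

text \<open>A closed piece of the path of minimal length does not meet its own starting point in
  between. If its end letters cancelled, then removing the two end steps would leave a shorter
  closed piece, or else two adjacent letters of \<open>w\<close> would cancel.\<close>

lemma fixed_point_simple_closed:
  assumes p: "p \<in> perm_tuples r n" and w: "w \<in> reduced_words r" "w \<noteq> []"
    and fp: "word_act p w x = x"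
  obtains a d where "0 < d" "a + d \<le> length w" "cyc_reduced_ends (subword w a d)"
    "simple_closed p (subword w a d) (word_act p (drop (a + d) w) x)"
proof -
  have ww: "w \<in> words r" using w by (simp add: reduced_words_def)
  define X where "X k = word_act p (drop k w) x" for k
  define P where "P d \<longleftrightarrow> 0 < d \<and> (\<exists>a. a + d \<le> length w \<and> X a = X (a + d))" for d
  have "P (length w)" using w(2) fp by (auto simp: P_def X_def intro!: exI[of _ 0])
  define d where "d = (LEAST d. P d)"
  have "P d" unfolding d_def by (rule LeastI) fact
  then obtain a where d0: "0 < d" and ad: "a + d \<le> length w" and Xa: "X a = X (a + d)"
    by (auto simp: P_def)
  have least: "\<not> P k" if "k < d" for k using not_less_Least[of k P] that by (simp add: d_def)
  have step: "X k = letter_act p (w ! k) (X (Suc k))" if "k < length w" for k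
    using that by (simp add: X_def Cons_nth_drop_Suc[symmetric])
  define m where "m = subword w a d"
  have lm: "length m = d" using ad by (simp add: m_def)
  have tail: "word_act p (drop k m) (X (a + d)) = X (a + k)" if "k \<le> d" for k
  proof -
    have "drop k m @ drop (a + d) w = drop (a + k) w"
    proof -
      have "drop k m = take (d - k) (drop (a + k) w)"
        by (simp add: m_def drop_take add.commute)
      moreover have "drop (a + d) w = drop (d - k) (drop (a + k) w)"
        using that by (simp add: add.commute)
      ultimately show ?thesis by (simp only: append_take_drop_id)
    qed
    then show ?thesis by (metis X_def word_act_append)
  qed
  have "simple_closed p m (X (a + d))"
    unfolding simple_closed_def
  proof (intro conjI allI impI)
    show "word_act p m (X (a + d)) = X (a + d)" using tail[of 0] Xa by simp
  next
    fix k assume k: "0 < k \<and> k < length m"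
    show "word_act p (drop k m) (X (a + d)) \<noteq> X (a + d)"
    proof
      assume "word_act p (drop k m) (X (a + d)) = X (a + d)"
      then have "X (a + k) = X ((a + k) + (d - k))" using tail[of k] k lm by simp
      then have "P (d - k)" using k lm ad by (auto simp: P_def intro!: exI[of _ "a + k"])
      then show False using least[of "d - k"] k lm by simp
    qed
  qed
  moreover have "cyc_reduced_ends m"
    unfolding cyc_reduced_ends_def
  proof (intro conjI notI)
    show "m = [] \<Longrightarrow> False" using lm d0 by simp
  next
    assume h: "hd m = letter_inv (last m)"
    have hm: "hd m = w ! a" using d0 ad by (simp add: m_def hd_drop_conv_nth)
    have "last m = m ! (d - 1)" using lm d0 by (metis last_conv_nth length_greater_0_conv)
    then have lst: "last m = w ! (a + d - 1)" using d0 ad by (simp add: m_def)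
    have inv: "w ! a = letter_inv (w ! (a + d - 1))" using h hm lst by simp
    consider "d = 1" | "d = 2" | "d > 2" using d0 by linarith
    then show False
    proof cases
      case 1
      then show False using inv by (metis add_diff_cancel_right' letter_inv_simps(4))
    next
      case 2
      then show False using reduced_words_no_cancel[OF w(1), of a] ad inv by simp
    next
      case 3
      have "X (Suc a) = letter_act p (letter_inv (w ! a)) (X a)"
        using step[of a] ad d0 letter_act_inv_cancel(1)[OF p words_nth[OF ww, of a]] by simp
      also have "\<dots> = letter_act p (w ! (a + d - 1)) (X (a + d))" using inv Xa by simp
      also have "\<dots> = X (a + d - 1)" using step[of "a + d - 1"] ad d0 by simp
      also have "a + d - 1 = Suc a + (d - 2)" using 3 by simp
      finally have "X (Suc a) = X (Suc a + (d - 2))" .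
      moreover have "0 < d - 2" "Suc a + (d - 2) \<le> length w" using 3 ad by simp_all
      ultimately have "P (d - 2)" unfolding P_def by blast
      then show False using least[of "d - 2"] 3 by simp
    qed
  qed
  ultimately show thesis using that[OF d0 ad] by (simp add: m_def X_def)
qed

definition isolated_roots ::
  "nat \<Rightarrow> nat \<Rightarrow> (nat \<times> bool) list \<Rightarrow> nat set \<Rightarrow> (nat \<Rightarrow> nat \<Rightarrow> nat) set" where
  "isolated_roots r n m I = {p \<in> perm_tuples r n. \<forall>z\<in>I.
     word_act p m z = z \<and> (\<forall>k. 0 < k \<and> k < length m \<longrightarrow> word_act p (drop k m) z \<notin> I)}"

text \<open>Let \<open>l0\<close> be the last letter of \<open>m\<close>. After its first step \<open>z \<mapsto> l0 z\<close>, the path from \<open>z \<in> I\<close> uses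
  no \<open>l0\<close>-edge that starts in \<open>I\<close>, so both tuples act alike along it. As the path closes up under
  both, following it backwards from \<open>z\<close> leads to the same point \<open>l0 z\<close>.\<close>

lemma isolated_roots_determined:
  assumes m: "m \<in> words r" "cyc_reduced_ends m"
    and p: "p \<in> isolated_roots r n m I" and p': "p' \<in> isolated_roots r n m I"
    and off_gen: "\<And>i. i \<noteq> fst (last m) \<Longrightarrow> p i = p' i"
    and off_I: "\<And>x. x \<notin> I \<Longrightarrow> letter_act p (last m) x = letter_act p' (last m) x"
  shows "p = p'"
proof -
  define l0 where "l0 = last m"
  define m' where "m' = butlast m"
  have mm: "m = m' @ [l0]" using m(2) by (simp add: m'_def l0_def cyc_reduced_ends_def)
  have l0: "fst l0 \<in> {1..r}" and m'w: "m' \<in> words r" using m(1) by (auto simp: mm)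
  have pt: "p \<in> perm_tuples r n" "p' \<in> perm_tuples r n"
    using p p' by (auto simp: isolated_roots_def)
  have "letter_act p l0 z = letter_act p' l0 z" for z
  proof (cases "z \<in> I")
    case False
    then show ?thesis using off_I by (simp add: l0_def)
  next
    case True
    have inner: "word_act p v (letter_act p l0 z) \<notin> I" if "m' = u @ v" "u \<noteq> []" for u v
    proof -
      have "drop (length u) m = v @ [l0]" using that by (simp add: mm)
      moreover have "0 < length u" "length u < length m" using that by (auto simp: mm)
      ultimately show ?thesis using p True unfolding isolated_roots_def
        by (metis (no_types, lifting) mem_Collect_eq word_act_append word_act_simps)
    qed
    have agree: "word_act p v (letter_act p l0 z) = word_act p' v (letter_act p l0 z)"
      if "m' = u @ v" for u v
      using that
    proof (induction v arbitrary: u)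
      case Nil
      then show ?case by simp
    next
      case (Cons l v)
      define x where "x = word_act p v (letter_act p l0 z)"
      have x': "x = word_act p' v (letter_act p l0 z)"
        using Cons.IH[of "u @ [l]"] Cons.prems by (simp add: x_def)
      have xI: "x \<notin> I" using inner[of "u @ [l]" v] Cons.prems by (simp add: x_def)
      have l: "fst l \<in> {1..r}" using m'w Cons.prems by auto
      consider "fst l \<noteq> fst l0" | "l = l0" | "l = letter_inv l0"
        by (cases l; cases l0) (auto simp: letter_inv_def)
      then have "letter_act p l x = letter_act p' l x"
      proof cases
        case 1
        then show ?thesis using off_gen by (simp add: letter_act_def l0_def)
      next
        case 2
        then show ?thesis using off_I xI by (simp add: l0_def)
      next
        case 3
        \<comment> \<open>An inverse step from \<open>x\<close> uses the \<open>l0\<close>-edge that starts where the step ends. This point is inner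
          except at the final step of the path, which the condition on the end letters excludes.\<close>
        have "u \<noteq> []"
        proof
          assume "u = []"
          then have "hd m = l" using Cons.prems by (simp add: mm)
          then show False using m(2) 3 by (simp add: cyc_reduced_ends_def l0_def)
        qed
        then have "letter_act p l x \<notin> I"
          using inner[OF Cons.prems] by (simp add: x_def)
        then have "letter_act p l0 (letter_act p l x) = letter_act p' l0 (letter_act p l x)"
          using off_I by (simp add: l0_def)
        moreover have "letter_act p l0 (letter_act p l x) = x"
          using letter_act_inv_cancel(2)[OF pt(1) l0] 3 by simp
        ultimately have "letter_act p' l x = letter_act p' l (letter_act p' l0 (letter_act p l x))"
          by simp
        then show ?thesis using letter_act_inv_cancel(1)[OF pt(2) l0] 3 by simp
      qed
      then show ?case using x' by (simp add: x_def)
    qed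
    have "word_act p' m' (letter_act p l0 z) = word_act p m z"
      using agree[of "[]" m'] by (simp add: mm)
    also have "\<dots> = z" using p True by (simp add: isolated_roots_def)
    also have "\<dots> = word_act p' m z" using p' True by (simp add: isolated_roots_def)
    also have "\<dots> = word_act p' m' (letter_act p' l0 z)" by (simp add: mm)
    finally show ?thesis
      using permutes_inj[OF word_act_permutes[OF pt(2) m'w]] by (auto dest: injD)
  qed
  then have "letter_act p l0 = letter_act p' l0" by auto
  then have "p (fst l0) = p' (fst l0)"
    using inv_inv_eq[OF permutes_bij[OF perm_tuples_permutes[OF pt(1) l0]]]
      inv_inv_eq[OF permutes_bij[OF perm_tuples_permutes[OF pt(2) l0]]]
    by (metis letter_act_def)
  then show ?thesis using off_gen by (metis ext l0_def)
qed

text \<open>Changes \<open>p\<close> at a single generator so that the letter \<open>l\<close>, which may be an inverse, acts by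
  its old action after \<open>\<tau>\<close>.\<close>

definition twist ::
  "nat \<times> bool \<Rightarrow> (nat \<Rightarrow> nat \<Rightarrow> nat) \<Rightarrow> (nat \<Rightarrow> nat) \<Rightarrow> (nat \<Rightarrow> nat \<Rightarrow> nat)" where
  "twist l p \<tau> = p(fst l := (if snd l then p (fst l) \<circ> \<tau> else inv' \<tau> \<circ> p (fst l)))"

lemma letter_act_twist:
  assumes "p \<in> perm_tuples r n" "fst l \<in> {1..r}" "\<tau> permutes {1..n}"
  shows "letter_act (twist l p \<tau>) l = letter_act p l \<circ> \<tau>"
proof -
  note q = perm_tuples_permutes[OF assms(1,2)]
  have "inv' (inv' \<tau> \<circ> p (fst l)) = inv' (p (fst l)) \<circ> inv' (inv' \<tau>)"
    by (rule o_inv_distrib[OF permutes_bij[OF permutes_inv[OF assms(3)]] permutes_bij[OF q]])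
  then show ?thesis
    by (simp add: twist_def letter_act_def permutes_inv_inv[OF assms(3)])
qed

text \<open>Twisting by a permutation of \<open>I\<close> alters the tuple only on edges that the rest of the tuple
  determines. Hence the pairs \<open>(p, \<tau>)\<close> inject into all tuples.\<close>

lemma card_isolated_roots:
  assumes m: "m \<in> words r" "cyc_reduced_ends m" and I: "I \<subseteq> {1..n}"
  shows "card (isolated_roots r n m I) * fact (card I) \<le> fact n ^ r"
proof -
  let ?l = "last m"
  let ?S = "{\<tau>. \<tau> permutes I}"
  have l: "fst ?l \<in> {1..r}"
    using m by (metis append_butlast_last_id cyc_reduced_ends_def words_simps(2,3))
  have S: "\<tau> permutes {1..n}" if "\<tau> \<in> ?S" for \<tau> using that I permutes_subset by blast
  have pt: "p \<in> perm_tuples r n" if "p \<in> isolated_roots r n m I" for p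
    using that by (simp add: isolated_roots_def)
  have "inj_on (\<lambda>(p, \<tau>). twist ?l p \<tau>) (isolated_roots r n m I \<times> ?S)"
  proof (rule inj_onI, clarify)
    fix p \<tau> p' \<tau>'
    assume p: "p \<in> isolated_roots r n m I" and p': "p' \<in> isolated_roots r n m I"
      and \<tau>: "\<tau> permutes I" "\<tau>' permutes I" and eq: "twist ?l p \<tau> = twist ?l p' \<tau>'"
    have act: "letter_act p ?l \<circ> \<tau> = letter_act p' ?l \<circ> \<tau>'"
      using letter_act_twist[OF pt[OF p] l S] letter_act_twist[OF pt[OF p'] l S] \<tau> eq
      by (metis mem_Collect_eq)
    have "p = p'"
    proof (rule isolated_roots_determined[OF m p p'])
      fix i assume "i \<noteq> fst ?l"
      then show "p i = p' i" using fun_cong[OF eq, of i] by (simp add: twist_def)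
    next
      fix x assume "x \<notin> I"
      then show "letter_act p ?l x = letter_act p' ?l x"
        using fun_cong[OF act, of x] \<tau> by (simp add: permutes_def)
    qed
    moreover have "\<tau> = \<tau>'"
      using act permutes_inj[OF letter_act_permutes[OF pt[OF p] l]] \<open>p = p'\<close>
      by (simp add: fun.inj_map_strong[of _ _ "letter_act p ?l"] fun_eq_iff inj_eq)
    ultimately show "p = p' \<and> \<tau> = \<tau>'" by simp
  qed
  moreover have "(\<lambda>(p, \<tau>). twist ?l p \<tau>) ` (isolated_roots r n m I \<times> ?S) \<subseteq> perm_tuples r n"
  proof clarify
    fix p \<tau> assume "p \<in> isolated_roots r n m I" and \<tau>: "\<tau> permutes I"
    then have p: "p \<in> perm_tuples r n" using pt by simp
    have "p (fst ?l) permutes {1..n}" "\<tau> permutes {1..n}" "inv' \<tau> permutes {1..n}"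
      using perm_tuples_permutes[OF p l] S \<tau> permutes_inv by auto
    then show "twist ?l p \<tau> \<in> perm_tuples r n"
      using p l unfolding perm_tuples_def twist_def
      by (auto intro!: fun_upd_in_PiE permutes_compose simp: PiE_iff extensional_def)
  qed
  ultimately have "card (isolated_roots r n m I \<times> ?S) \<le> card (perm_tuples r n)"
    by (rule card_inj_on_le) (rule finite_perm_tuples)
  moreover have "card ?S = fact (card I)"
    using I finite_subset by (intro card_permutations) auto
  ultimately show ?thesis by (simp add: card_cartesian_product card_perm_tuples)
qed

text \<open>An independent set in a graph of bounded degree: the edges join \<open>z\<close> and \<open>f k z\<close>, so each \<open>k\<close>
  contributes at most two neighbours to a point. In a maximal independent set \<open>I\<close>, every point of
  \<open>V\<close> lies in \<open>I\<close> or is adjacent to it.\<close>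

lemma independent_subset:
  fixes f :: "'k \<Rightarrow> 'a \<Rightarrow> 'a"
  assumes V: "finite V" and K: "finite K"
    and inj: "\<And>k. k \<in> K \<Longrightarrow> inj_on (f k) V"
    and nofix: "\<And>k z. k \<in> K \<Longrightarrow> z \<in> V \<Longrightarrow> f k z \<noteq> z"
  obtains I where "I \<subseteq> V" "\<And>k z. k \<in> K \<Longrightarrow> z \<in> I \<Longrightarrow> f k z \<notin> I"
    "card V \<le> (2 * card K + 1) * card I"
proof -
  define F where "F = {I. I \<subseteq> V \<and> (\<forall>k\<in>K. \<forall>z\<in>I. f k z \<notin> I)}"
  have "finite F" using V by (auto simp: F_def)
  moreover have "{} \<in> F" by (simp add: F_def)
  ultimately obtain I where I: "I \<in> F" and maxI: "\<And>J. J \<in> F \<Longrightarrow> I \<subseteq> J \<Longrightarrow> J = I"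
    using finite_has_maximal[of F] by (metis empty_iff)
  have IV: "I \<subseteq> V" and ind: "\<And>k z. k \<in> K \<Longrightarrow> z \<in> I \<Longrightarrow> f k z \<notin> I"
    using I by (auto simp: F_def)
  have fI: "finite I" using IV V finite_subset by auto
  let ?out = "\<lambda>k. f k ` I" and ?inn = "\<lambda>k. {z \<in> V. f k z \<in> I}"
  have "V \<subseteq> I \<union> (\<Union>k\<in>K. ?out k \<union> ?inn k)"
  proof
    fix z assume z: "z \<in> V"
    show "z \<in> I \<union> (\<Union>k\<in>K. ?out k \<union> ?inn k)"
    proof (rule ccontr)
      assume n: "z \<notin> I \<union> (\<Union>k\<in>K. ?out k \<union> ?inn k)"
      then have "insert z I \<in> F" using z IV ind nofix by (auto simp: F_def)
      then show False using maxI[of "insert z I"] n by auto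
    qed
  qed
  then have "card V \<le> card (I \<union> (\<Union>k\<in>K. ?out k \<union> ?inn k))"
    using fI K V by (intro card_mono) auto
  also have "\<dots> \<le> card I + card (\<Union>k\<in>K. ?out k \<union> ?inn k)" by (rule card_Un_le)
  also have "card (\<Union>k\<in>K. ?out k \<union> ?inn k) \<le> (\<Sum>k\<in>K. card (?out k \<union> ?inn k))"
    by (rule card_UN_le) fact
  also have "\<dots> \<le> (\<Sum>k\<in>K. 2 * card I)"
  proof (rule sum_mono)
    fix k assume k: "k \<in> K"
    have "card (?inn k) \<le> card I"
      using inj[OF k] fI by (intro card_inj_on_le[of "f k"]) (auto intro: inj_on_subset)
    moreover have "card (?out k) \<le> card I" using fI by (rule card_image_le)
    ultimately show "card (?out k \<union> ?inn k) \<le> 2 * card I"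
      using card_Un_le[of "?out k" "?inn k"] by simp
  qed
  finally have "card V \<le> (2 * card K + 1) * card I" by (simp add: algebra_simps)
  then show thesis using that IV ind by blast
qed

text \<open>The factor \<open>2 * length m + 1\<close> is lost in making the cycles independent, and \<open>2 ^ n\<close> bounds the
  number of sets of \<open>t\<close> starting points.\<close>

lemma card_many_simple_closed:
  assumes m: "m \<in> words r" "cyc_reduced_ends m"
  shows "card {p \<in> perm_tuples r n.
      (2 * length m + 1) * t \<le> card {z \<in> {1..n}. simple_closed p m z}} * fact t
    \<le> 2 ^ n * fact n ^ r" (is "card ?bad * _ \<le> _")
proof -
  let ?II = "{I. I \<subseteq> {1..n} \<and> card I = t}"
  have "?bad \<subseteq> (\<Union>I\<in>?II. isolated_roots r n m I)"
  proof
    fix p assume "p \<in> ?bad"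
    then have p: "p \<in> perm_tuples r n"
      and big: "(2 * length m + 1) * t \<le> card {z \<in> {1..n}. simple_closed p m z}" by auto
    let ?V = "{z \<in> {1..n}. simple_closed p m z}" and ?K = "{k. 0 < k \<and> k < length m}"
    obtain I where I: "I \<subseteq> ?V" "\<And>k z. k \<in> ?K \<Longrightarrow> z \<in> I \<Longrightarrow> word_act p (drop k m) z \<notin> I"
      and cI: "card ?V \<le> (2 * card ?K + 1) * card I"
    proof (rule independent_subset[of ?V ?K "\<lambda>k. word_act p (drop k m)"])
      fix k assume "k \<in> ?K"
      show "inj_on (word_act p (drop k m)) ?V"
        using permutes_inj[OF word_act_permutes[OF p]] words_take_drop[OF m(1)]
        by (metis inj_on_subset subset_UNIV)
    qed (auto simp: simple_closed_def)
    have "card ?K \<le> card {..<length m}" by (rule card_mono) auto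
    then have "(2 * card ?K + 1) * card I \<le> (2 * length m + 1) * card I"
      by (intro mult_right_mono) auto
    then have "(2 * length m + 1) * t \<le> (2 * length m + 1) * card I" using big cI by linarith
    then have "t \<le> card I" by (rule mult_left_le_imp_le) simp
    then obtain J where J: "J \<subseteq> I" "card J = t"
      by (metis obtain_subset_with_card_n)
    have "J \<in> ?II" using J I(1) by auto
    moreover have "p \<in> isolated_roots r n m J"
      unfolding isolated_roots_def
    proof (intro CollectI conjI ballI allI impI)
      fix z assume "z \<in> J"
      then have z: "z \<in> I" "z \<in> ?V" using J(1) I(1) by auto
      show "word_act p m z = z" using z by (simp add: simple_closed_def)
      fix k assume "0 < k \<and> k < length m"
      then show "word_act p (drop k m) z \<notin> J" using I(2)[of k z] z(1) J(1) by blast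
    qed fact
    ultimately show "p \<in> (\<Union>I\<in>?II. isolated_roots r n m I)" by blast
  qed
  moreover have fin: "finite ?II" by simp
  moreover have "finite (isolated_roots r n m I)" for I
    by (simp add: isolated_roots_def finite_perm_tuples)
  ultimately have "card ?bad \<le> card (\<Union>I\<in>?II. isolated_roots r n m I)"
    by (intro card_mono) auto
  also have "\<dots> \<le> (\<Sum>I\<in>?II. card (isolated_roots r n m I))" by (rule card_UN_le) fact
  finally have "card ?bad * fact t \<le> (\<Sum>I\<in>?II. card (isolated_roots r n m I) * fact (card I))"
    by (simp add: sum_distrib_right[symmetric])
  also have "\<dots> \<le> (\<Sum>I\<in>?II. fact n ^ r)"
    using card_isolated_roots[OF m] by (intro sum_mono) auto
  also have "\<dots> \<le> 2 ^ n * fact n ^ r"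
  proof -
    have "card ?II \<le> card (Pow {1..n})" by (rule card_mono) auto
    then show ?thesis by (simp add: card_Pow)
  qed
  finally show ?thesis .
qed

text \<open>Every fixed point of \<open>w\<close> is carried to the start of a simple closed path of one of at most
  \<open>(length w)\<^sup>2\<close> subwords, injectively for each of them, so one subword has many such starting points.\<close>

lemma card_many_fixed_points:
  assumes w: "w \<in> reduced_words r" "w \<noteq> []"
  shows "card {p \<in> perm_tuples r n.
      (length w)\<^sup>2 * (2 * length w + 1) * t \<le> card {x \<in> {1..n}. word_act p w x = x}} * fact t
    \<le> (length w)\<^sup>2 * 2 ^ n * fact n ^ r" (is "card ?bad * _ \<le> _")
proof -
  let ?L = "length w"
  define Q where "Q = {(a, d). 0 < d \<and> a + d \<le> ?L \<and> cyc_reduced_ends (subword w a d)}"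
  define A where "A = (\<lambda>(a, d). {p \<in> perm_tuples r n. (2 * length (subword w a d) + 1) * t
      \<le> card {z \<in> {1..n}. simple_closed p (subword w a d) z}})"
  have Qsub: "Q \<subseteq> {..<?L} \<times> {1..?L}" by (auto simp: Q_def)
  then have Qfin: "finite Q" by (rule finite_subset) simp
  have Qcard: "card Q \<le> ?L\<^sup>2"
    using card_mono[OF _ Qsub] by (simp add: power2_eq_square)
  have ww: "w \<in> words r" using w by (simp add: reduced_words_def)
  have sub: "?bad \<subseteq> (\<Union>q\<in>Q. A q)"
  proof
    fix p assume "p \<in> ?bad"
    then have p: "p \<in> perm_tuples r n"
      and big: "?L\<^sup>2 * (2 * ?L + 1) * t \<le> card {x \<in> {1..n}. word_act p w x = x}" by auto
    define V where "V = (\<lambda>(a, d). {z \<in> {1..n}. simple_closed p (subword w a d) z})"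
    define W where "W = (\<lambda>(a, d). {x \<in> {1..n}.
        simple_closed p (subword w a d) (word_act p (drop (a + d) w) x)})"
    have WV: "card (W q) \<le> card (V q)" for q
    proof (cases q)
      case (Pair a d)
      have "word_act p (drop (a + d) w) permutes {1..n}"
        using word_act_permutes[OF p] words_take_drop[OF ww] by blast
      then show ?thesis
        unfolding Pair W_def V_def prod.case
        by (intro card_inj_on_le[of "word_act p (drop (a + d) w)"])
          (auto intro: inj_on_subset[OF permutes_inj] dest: permutes_in_image)
    qed
    have "{x \<in> {1..n}. word_act p w x = x} \<subseteq> (\<Union>q\<in>Q. W q)"
    proof clarify
      fix x assume x: "x \<in> {1..n}" "word_act p w x = x"
      obtain a d where "0 < d" "a + d \<le> ?L" "cyc_reduced_ends (subword w a d)"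
        "simple_closed p (subword w a d) (word_act p (drop (a + d) w) x)"
        using fixed_point_simple_closed[OF p w x(2)] by blast
      then have "(a, d) \<in> Q" "x \<in> W (a, d)" using x(1) by (auto simp: Q_def W_def)
      then show "x \<in> (\<Union>q\<in>Q. W q)" by blast
    qed
    then have "card {x \<in> {1..n}. word_act p w x = x} \<le> card (\<Union>q\<in>Q. W q)"
      using Qfin by (intro card_mono) (auto simp: W_def)
    also have "\<dots> \<le> (\<Sum>q\<in>Q. card (W q))" by (rule card_UN_le) fact
    also have "\<dots> \<le> (\<Sum>q\<in>Q. card (V q))" by (intro sum_mono WV)
    finally have le: "?L\<^sup>2 * (2 * ?L + 1) * t \<le> (\<Sum>q\<in>Q. card (V q))" using big by linarith
    show "p \<in> (\<Union>q\<in>Q. A q)"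
    proof (rule ccontr)
      assume np: "p \<notin> (\<Union>q\<in>Q. A q)"
      have lt: "card (V q) < (2 * ?L + 1) * t" if q: "q \<in> Q" for q
      proof -
        obtain a d where qq: "q = (a, d)" by (cases q)
        have "card (V q) < (2 * length (subword w a d) + 1) * t"
          using np q p by (auto simp: A_def V_def qq not_le)
        also have "\<dots> \<le> (2 * ?L + 1) * t" by (intro mult_right_mono) auto
        finally show ?thesis .
      qed
      have "(0, 1) \<in> Q"
        using w(2) letter_inv_simps(4)
        by (cases w) (auto simp: Q_def cyc_reduced_ends_def simp del: letter_inv_simps dest: sym)
      then have "Q \<noteq> {}" by auto
      then have "(\<Sum>q\<in>Q. card (V q)) < (\<Sum>q\<in>Q. (2 * ?L + 1) * t)"
        using sum_strict_mono[OF Qfin _ lt] by simp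
      also have "\<dots> \<le> ?L\<^sup>2 * ((2 * ?L + 1) * t)" using Qcard by (simp add: mult_right_mono)
      finally show False using le by (simp only: mult.assoc)
    qed
  qed
  have "finite (A q)" for q by (cases q) (simp add: A_def finite_perm_tuples)
  then have "card ?bad \<le> card (\<Union>q\<in>Q. A q)" using sub Qfin by (intro card_mono) auto
  also have "\<dots> \<le> (\<Sum>q\<in>Q. card (A q))" by (rule card_UN_le) fact
  finally have "card ?bad * fact t \<le> (\<Sum>q\<in>Q. card (A q) * fact t)"
    by (simp add: sum_distrib_right[symmetric])
  also have "\<dots> \<le> (\<Sum>q\<in>Q. 2 ^ n * fact n ^ r)"
  proof (rule sum_mono)
    fix q assume "q \<in> Q"
    then obtain a d where q: "q = (a, d)" "cyc_reduced_ends (subword w a d)"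
      by (auto simp: Q_def)
    have "subword w a d \<in> words r" using ww words_take_drop by blast
    from card_many_simple_closed[OF this q(2)]
    show "card (A q) * fact t \<le> 2 ^ n * fact n ^ r" by (simp add: A_def q(1))
  qed
  also have "\<dots> \<le> ?L\<^sup>2 * 2 ^ n * fact n ^ r" using Qcard by (simp add: mult_right_mono)
  finally show ?thesis .
qed

section \<open>Homomorphisms from the free group as tuples of permutations\<close>

definition gens :: "nat \<Rightarrow> (nat \<Rightarrow> 'g) \<Rightarrow> ('g \<Rightarrow> nat \<Rightarrow> nat) \<Rightarrow> nat \<Rightarrow> nat \<Rightarrow> nat" where
  "gens r s \<sigma> = (\<lambda>i\<in>{1..r}. \<sigma> (s i))"

lemma free_group_s_closed: "free_group G s r \<Longrightarrow> i \<in> {1..r} \<Longrightarrow> s i \<in> carrier G"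
  by (auto simp: free_group_def)

lemma free_group_word_val:
  assumes "free_group G s r" "w \<in> words r"
  shows "word_val G s w \<in> carrier G"
  using assms by (intro word_val_closed) (auto simp: free_group_def)

lemma word_val_simps [simp]:
  "word_val G s [] = \<one>\<^bsub>G\<^esub>" "word_val G s (l # w) = letter_val G s l \<otimes>\<^bsub>G\<^esub> word_val G s w"
  by (simp_all add: word_val_def)

lemma letter_val_closed:
  assumes "free_group G s r" "fst l \<in> {1..r}"
  shows "letter_val G s l \<in> carrier G"
proof -
  interpret group G using assms by (simp add: free_group_def)
  show ?thesis using free_group_s_closed[OF assms]
    by (simp add: letter_val_def case_prod_beta)
qed

lemma word_val_append:
  assumes G: "free_group G s r" and uv: "u \<in> words r" "v \<in> words r"
  shows "word_val G s (u @ v) = word_val G s u \<otimes>\<^bsub>G\<^esub> word_val G s v"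
proof -
  interpret group G using G by (simp add: free_group_def)
  show ?thesis
    using uv(1)
  proof (induction u)
    case Nil
    then show ?case using free_group_word_val[OF G uv(2)] by simp
  next
    case (Cons l u)
    then have "fst l \<in> {1..r}" "u \<in> words r" by simp_all
    then show ?case
      using Cons.IH letter_val_closed[OF G] free_group_word_val[OF G] uv(2)
      by (simp add: m_assoc)
  qed
qed

lemma gens_perm_tuples:
  assumes "free_group G s r" "\<sigma> \<in> Hom_Sym G n"
  shows "gens r s \<sigma> \<in> perm_tuples r n"
  using assms free_group_s_closed[OF assms(1)]
  by (auto simp: gens_def perm_tuples_def Hom_Sym_def hom_def sym_group_def)

lemma Hom_Sym_simps:
  assumes "\<sigma> \<in> Hom_Sym G n" "g \<in> carrier G" "h \<in> carrier G"
  shows "\<sigma> (g \<otimes>\<^bsub>G\<^esub> h) x = \<sigma> g (\<sigma> h x)" and "\<sigma> g permutes {1..n}"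
  using assms by (auto simp: Hom_Sym_def hom_def sym_group_def)

lemma Hom_Sym_letter_val:
  assumes G: "free_group G s r" and \<sigma>: "\<sigma> \<in> Hom_Sym G n" and l: "fst l \<in> {1..r}"
  shows "\<sigma> (letter_val G s l) = letter_act (gens r s \<sigma>) l"
proof -
  interpret group G using G by (simp add: free_group_def)
  interpret \<sigma>: group_hom G "sym_group n" \<sigma>
    using \<sigma> group_axioms sym_group_is_group
    by (simp add: Hom_Sym_def group_hom_def group_hom_axioms_def)
  have s: "s (fst l) \<in> carrier G" using free_group_s_closed[OF G l] .
  have "\<sigma> (s (fst l)) \<in> carrier (sym_group n)" using s by simp
  then show ?thesis
    using s l by (simp add: letter_val_def letter_act_def gens_def case_prod_beta)
qed

lemma Hom_Sym_word_val:
  assumes G: "free_group G s r" and \<sigma>: "\<sigma> \<in> Hom_Sym G n" and w: "w \<in> words r"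
  shows "\<sigma> (word_val G s w) x = word_act (gens r s \<sigma>) w x"
  using w
proof (induction w)
  case Nil
  interpret group G using G by (simp add: free_group_def)
  interpret \<sigma>: group_hom G "sym_group n" \<sigma>
    using \<sigma> group_axioms sym_group_is_group
    by (simp add: Hom_Sym_def group_hom_def group_hom_axioms_def)
  show ?case using \<sigma>.hom_one by (simp add: sym_group_one)
next
  case (Cons l w)
  then have "fst l \<in> {1..r}" "w \<in> words r" by simp_all
  then show ?case
    using Cons.IH Hom_Sym_letter_val[OF G \<sigma>] letter_val_closed[OF G] free_group_word_val[OF G]
    by (simp add: Hom_Sym_simps(1)[OF \<sigma>])
qed

text \<open>Cancelling adjacent inverse letters changes neither the value in \<open>G\<close> nor any action, which is
  what makes the extension of a tuple to \<open>G\<close> along reduced words multiplicative.\<close>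

lemma word_reduction:
  assumes G: "free_group G s r" and w: "w \<in> words r"
  shows "\<exists>w'\<in>reduced_words r. word_val G s w' = word_val G s w \<and>
    (\<forall>n. \<forall>p\<in>perm_tuples r n. word_act p w' = word_act p w)"
  using w
proof (induction w)
  case Nil
  have "[] \<in> reduced_words r" by (simp add: reduced_words_def)
  then show ?case by blast
next
  case (Cons l w)
  interpret group G using G by (simp add: free_group_def)
  have l: "fst l \<in> {1..r}" and w: "w \<in> words r" using Cons.prems by simp_all
  obtain w' where w': "w' \<in> reduced_words r" "word_val G s w' = word_val G s w"
    "\<And>n p. p \<in> perm_tuples r n \<Longrightarrow> word_act p w' = word_act p w"
    using Cons.IH[OF w] by blast
  have act: "word_act p (l # w) x = letter_act p l (word_act p w' x)"
    if "p \<in> perm_tuples r n" for p n x using w'(3)[OF that] by simp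
  show ?case
  proof (cases "\<exists>v. w' = letter_inv l # v")
    case True
    then obtain v where v: "w' = letter_inv l # v" by blast
    have v_red: "v \<in> reduced_words r"
      using w'(1) by (auto simp: v reduced_words_def successively_Cons)
    then have vw: "v \<in> words r" by (simp add: reduced_words_def)
    have "letter_val G s l \<otimes>\<^bsub>G\<^esub> letter_val G s (letter_inv l) = \<one>\<^bsub>G\<^esub>"
      using free_group_s_closed[OF G l] by (simp add: letter_val_def letter_inv_def case_prod_beta)
    then have "word_val G s v =
        letter_val G s l \<otimes>\<^bsub>G\<^esub> (letter_val G s (letter_inv l) \<otimes>\<^bsub>G\<^esub> word_val G s v)"
      using letter_val_closed[OF G] l free_group_word_val[OF G vw] by (simp add: m_assoc[symmetric])
    then have "word_val G s v = word_val G s (l # w)" using w'(2) by (simp add: v)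
    moreover have "word_act p v = word_act p (l # w)" if "p \<in> perm_tuples r n" for p n
      using act[OF that] letter_act_inv_cancel(2)[OF that l] by (auto simp: v)
    ultimately show ?thesis using v_red by blast
  next
    case False
    have "l # w' \<in> reduced_words r"
    proof (cases w')
      case Nil
      then show ?thesis using l by (simp add: reduced_words_def)
    next
      case (Cons l' v)
      have "l' \<noteq> letter_inv l" using False Cons by blast
      then have "\<not> (fst l = fst l' \<and> snd l \<noteq> snd l')"
        by (auto simp: letter_inv_def prod_eq_iff)
      then show ?thesis using w'(1) l Cons
        by (auto simp: reduced_words_def successively_Cons case_prod_beta)
    qed
    moreover have "word_val G s (l # w') = word_val G s (l # w)" using w'(2) by simp
    moreover have "word_act p (l # w') = word_act p (l # w)" if "p \<in> perm_tuples r n" for p n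
      using act[OF that] by auto
    ultimately show ?thesis by blast
  qed
qed

lemma Hom_Sym_extend:
  assumes G: "free_group G s r" and p: "p \<in> perm_tuples r n"
  shows "\<exists>\<sigma>\<in>Hom_Sym G n. gens r s \<sigma> = p"
proof -
  interpret group G using G by (simp add: free_group_def)
  have bij: "bij_betw (word_val G s) (reduced_words r) (carrier G)"
    using G by (simp add: free_group_def)
  define red where "red = inv_into (reduced_words r) (word_val G s)"
  have red: "red g \<in> reduced_words r" "word_val G s (red g) = g" if "g \<in> carrier G" for g
    using that bij unfolding red_def bij_betw_def
    by (auto simp: f_inv_into_f intro: inv_into_into)
  have red_eq: "red g = w" if "w \<in> reduced_words r" "word_val G s w = g" for w g
    using that bij unfolding red_def by (auto simp: bij_betw_def)
  have redw: "red g \<in> words r" if "g \<in> carrier G" for g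
    using red[OF that] by (simp add: reduced_words_def)
  define \<sigma> where "\<sigma> = (\<lambda>g\<in>carrier G. word_act p (red g))"
  have "\<sigma> \<in> hom G (sym_group n)"
  proof (rule homI)
    show "\<sigma> g \<in> carrier (sym_group n)" if "g \<in> carrier G" for g
      using that word_act_permutes[OF p redw] by (simp add: \<sigma>_def sym_group_def)
  next
    fix g h assume gh: "g \<in> carrier G" "h \<in> carrier G"
    then have "red g @ red h \<in> words r" using redw by simp
    from word_reduction[OF G this] obtain w' where w': "w' \<in> reduced_words r"
      "word_val G s w' = word_val G s (red g @ red h)"
      "word_act p w' = word_act p (red g @ red h)" using p by blast
    have "word_val G s w' = g \<otimes>\<^bsub>G\<^esub> h"
      using w'(2) gh redw red(2) by (simp add: word_val_append[OF G])
    then have "red (g \<otimes>\<^bsub>G\<^esub> h) = w'" using red_eq w'(1) by blast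
    then show "\<sigma> (g \<otimes>\<^bsub>G\<^esub> h) = \<sigma> g \<otimes>\<^bsub>sym_group n\<^esub> \<sigma> h"
      using gh w'(3) by (auto simp: \<sigma>_def sym_group_def)
  qed
  then have "\<sigma> \<in> Hom_Sym G n" by (simp add: Hom_Sym_def \<sigma>_def)
  moreover have "gens r s \<sigma> = p"
  proof (rule extensionalityI[of _ "{1..r}"])
    show "p \<in> extensional {1..r}" using p by (simp add: perm_tuples_def PiE_def)
    fix i assume i: "i \<in> {1..r}"
    have "red (s i) = [(i, True)]"
      using i free_group_s_closed[OF G i]
      by (intro red_eq) (auto simp: reduced_words_def letter_val_def)
    then show "gens r s \<sigma> i = p i"
      using i free_group_s_closed[OF G i]
      by (auto simp: gens_def \<sigma>_def letter_act_def)
  qed (simp add: gens_def)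
  ultimately show ?thesis by blast
qed

lemma inj_on_gens: "free_group G s r \<Longrightarrow> inj_on (gens r s) (Hom_Sym G n)"
proof (rule inj_onI)
  fix \<sigma> \<tau> assume G: "free_group G s r" and h: "\<sigma> \<in> Hom_Sym G n" "\<tau> \<in> Hom_Sym G n"
    and eq: "gens r s \<sigma> = gens r s \<tau>"
  show "\<sigma> = \<tau>"
  proof (rule Hom_Sym_eqI[OF G h])
    fix i assume "i \<in> {1..r}"
    then show "\<sigma> (s i) = \<tau> (s i)" using fun_cong[OF eq, of i] by (simp add: gens_def)
  qed
qed

section \<open>The size of balls\<close>

lemma word_length_le:
  "w \<in> words r \<Longrightarrow> word_length G s r (word_val G s w) \<le> length w"
  unfolding word_length_def by (rule Least_le) blast

lemma word_length_witness:
  assumes "free_group G s r" "g \<in> carrier G"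
  obtains w where "w \<in> words r" "length w = word_length G s r g" "word_val G s w = g"
proof -
  have "g \<in> word_val G s ` reduced_words r"
    using assms by (simp add: free_group_def bij_betw_def)
  then have "\<exists>l. \<exists>w\<in>words r. length w = l \<and> word_val G s w = g"
    by (auto simp: reduced_words_def)
  from LeastI_ex[OF this] show thesis using that by (auto simp: word_length_def)
qed

lemma word_ball_eq:
  assumes "free_group G s r"
  shows "word_ball G s r g k = (\<lambda>w. word_val G s w \<otimes>\<^bsub>G\<^esub> g) ` {w \<in> words r. length w \<le> k}"
proof (intro equalityI subsetI)
  fix x assume "x \<in> word_ball G s r g k"
  then obtain h where h: "x = h \<otimes>\<^bsub>G\<^esub> g" "h \<in> carrier G" "word_length G s r h \<le> k"
    by (auto simp: word_ball_def)
  with word_length_witness[OF assms h(2)]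
  show "x \<in> (\<lambda>w. word_val G s w \<otimes>\<^bsub>G\<^esub> g) ` {w \<in> words r. length w \<le> k}"
    by (metis (mono_tags, lifting) image_eqI mem_Collect_eq)
next
  fix x assume "x \<in> (\<lambda>w. word_val G s w \<otimes>\<^bsub>G\<^esub> g) ` {w \<in> words r. length w \<le> k}"
  then obtain w where "w \<in> words r" "length w \<le> k" "x = word_val G s w \<otimes>\<^bsub>G\<^esub> g" by auto
  then show "x \<in> word_ball G s r g k"
    using free_group_word_val[OF assms] word_length_le[of w r G s]
    by (auto simp: word_ball_def intro!: exI[of _ "word_val G s w"])
qed

lemma word_ball_subset:
  assumes "free_group G s r" "g \<in> carrier G"
  shows "word_ball G s r g k \<subseteq> carrier G"
proof -
  interpret group G using assms by (simp add: free_group_def)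
  show ?thesis using assms(2) by (auto simp: word_ball_def)
qed

lemma card_word_ball:
  assumes "free_group G s r"
  shows "finite (word_ball G s r g k)" "card (word_ball G s r g k) \<le> (2 * r + 1) ^ k"
proof -
  let ?A = "{1..r} \<times> (UNIV :: bool set)"
  have eq: "{w \<in> words r. length w \<le> k} = {w. set w \<subseteq> ?A \<and> length w \<le> k}"
    by (auto simp: words_def lists_eq_set)
  have fin: "finite {w \<in> words r. length w \<le> k}"
    unfolding eq by (rule finite_lists_length_le) simp
  have "card {w \<in> words r. length w \<le> k} = (\<Sum>i\<le>k. (2 * r) ^ i)"
    unfolding eq by (subst card_lists_length_le) (simp_all add: card_cartesian_product mult.commute)
  also have "\<dots> \<le> (2 * r + 1) ^ k"
  proof (induction k)
    case (Suc k)
    have "(2 * r) ^ k \<le> (2 * r + 1) ^ k" by (rule power_mono) auto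
    then have "2 * r * (2 * r) ^ k \<le> 2 * r * (2 * r + 1) ^ k" by (rule mult_left_mono) simp
    then have "(\<Sum>i\<le>k. (2 * r) ^ i) + 2 * r * (2 * r) ^ k \<le>
        (2 * r + 1) ^ k + 2 * r * (2 * r + 1) ^ k"
      using Suc by (rule add_mono[rotated])
    then show ?case by (simp only: sum.atMost_Suc power_Suc distrib_right mult_1 add.commute)
  qed simp
  finally have le: "card {w \<in> words r. length w \<le> k} \<le> (2 * r + 1) ^ k" .
  show "finite (word_ball G s r g k)" unfolding word_ball_eq[OF assms] using fin by simp
  show "card (word_ball G s r g k) \<le> (2 * r + 1) ^ k"
    unfolding word_ball_eq[OF assms] using card_image_le[OF fin] le le_trans by blast
qed

section \<open>Few homomorphisms are not sofic\<close>

text \<open>If \<open>\<sigma>\<close> is not sofic, then at least \<open>\<delta> n\<close> points are fixed by a nontrivial element of \<open>D\<close>, so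
  one element of \<open>D\<close> fixes a positive fraction of them and \<open>card_many_fixed_points\<close> applies to
  its reduced word.\<close>

lemma card_not_sofic:
  assumes G: "free_group G s r" and D: "finite D" "D \<subseteq> carrier G" and \<delta>: "\<delta> > 0"
  obtains c :: real and C :: nat where "c > 0"
    "\<And>n. n > 0 \<Longrightarrow> card {\<sigma> \<in> Hom_Sym G n. \<not> sofic G D \<delta> n \<sigma>} * fact (nat \<lfloor>c * n\<rfloor>)
      \<le> C * 2 ^ n * fact n ^ r"
proof -
  let ?D = "D - {\<one>\<^bsub>G\<^esub>}"
  have fD: "finite ?D" using D by simp
  have "\<exists>w. w \<in> reduced_words r \<and> word_val G s w = g" if "g \<in> ?D" for g
  proof -
    have "g \<in> word_val G s ` reduced_words r"
      using that G D by (auto simp: free_group_def bij_betw_def)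
    then show ?thesis by auto
  qed
  then obtain w where w: "w g \<in> reduced_words r" "word_val G s (w g) = g" if "g \<in> ?D" for g
    by metis
  have wne: "w g \<noteq> []" if "g \<in> ?D" for g using w(2)[OF that] that by auto
  have ww: "w g \<in> words r" if "g \<in> ?D" for g using w(1)[OF that] by (simp add: reduced_words_def)
  \<comment> \<open>\<open>k g * t\<close> fixed points are what the count for the word of \<open>g\<close> needs. The constant \<open>c\<close> makes
    \<open>t \<le> c n\<close> small enough for this to hold for some \<open>g\<close>; the summands 1 keep the denominator
    positive also when \<open>D\<close> has no nontrivial element.\<close>
  define k where "k g = (length (w g))\<^sup>2 * (2 * length (w g) + 1)" for g
  define K where "K = (\<Sum>g\<in>?D. k g) + 1"
  have kK: "k g \<le> K" if "g \<in> ?D" for g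
    using member_le_sum[of g ?D k] fD that by (simp add: K_def)
  define c where "c = \<delta> / (real (card ?D + 1) * real K)"
  define C where "C = (\<Sum>g\<in>?D. (length (w g))\<^sup>2)"
  have "real K > 0" by (simp only: K_def of_nat_0_less_iff)
  then have c: "c > 0" using \<delta> unfolding c_def by (intro divide_pos_pos mult_pos_pos) auto
  have "card {\<sigma> \<in> Hom_Sym G n. \<not> sofic G D \<delta> n \<sigma>} * fact (nat \<lfloor>c * n\<rfloor>)
      \<le> C * 2 ^ n * fact n ^ r" if n: "n > 0" for n
  proof -
    define t where "t = nat \<lfloor>c * n\<rfloor>"
    have t: "real K * real t \<le> \<delta> * n / (card ?D + 1)"
    proof -
      have "real t \<le> c * n" using c by (simp add: t_def)
      then have "real K * real t \<le> real K * (c * n)" by (intro mult_left_mono) auto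
      also have "\<dots> = \<delta> * n / (card ?D + 1)" using \<open>real K > 0\<close> by (simp add: c_def)
      finally show ?thesis .
    qed
    define bad where "bad g = {p \<in> perm_tuples r n.
      k g * t \<le> card {x \<in> {1..n}. word_act p (w g) x = x}}" for g
    have "gens r s ` {\<sigma> \<in> Hom_Sym G n. \<not> sofic G D \<delta> n \<sigma>} \<subseteq> (\<Union>g\<in>?D. bad g)"
    proof clarify
      fix \<sigma> assume \<sigma>: "\<sigma> \<in> Hom_Sym G n" and ns: "\<not> sofic G D \<delta> n \<sigma>"
      let ?F = "\<lambda>g. {x \<in> {1..n}. \<sigma> g x = x}"
      have cover: "{1..n} = {j \<in> {1..n}. \<forall>g\<in>?D. \<sigma> g j \<noteq> j} \<union> (\<Union>g\<in>?D. ?F g)" by auto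
      have "n = card ({j \<in> {1..n}. \<forall>g\<in>?D. \<sigma> g j \<noteq> j} \<union> (\<Union>g\<in>?D. ?F g))"
        using arg_cong[OF cover, of card] by simp
      also have "\<dots> \<le> card {j \<in> {1..n}. \<forall>g\<in>?D. \<sigma> g j \<noteq> j} + card (\<Union>g\<in>?D. ?F g)"
        by (rule card_Un_le)
      also have "card (\<Union>g\<in>?D. ?F g) \<le> (\<Sum>g\<in>?D. card (?F g))" by (rule card_UN_le) fact
      finally have "real n \<le> (1 - \<delta>) * n + real (\<Sum>g\<in>?D. card (?F g))"
        using ns by (simp add: sofic_def not_less del: of_nat_sum)
      then have sum: "\<delta> * n \<le> (\<Sum>g\<in>?D. real (card (?F g)))" by (simp add: algebra_simps)
      show "gens r s \<sigma> \<in> (\<Union>g\<in>?D. bad g)"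
      proof (rule ccontr)
        assume nb: "gens r s \<sigma> \<notin> (\<Union>g\<in>?D. bad g)"
        have "real (card (?F g)) \<le> \<delta> * n / (card ?D + 1)" if g: "g \<in> ?D" for g
        proof -
          have "?F g = {x \<in> {1..n}. word_act (gens r s \<sigma>) (w g) x = x}"
            using Hom_Sym_word_val[OF G \<sigma> ww[OF g]] w(2)[OF g] by simp
          then have "card (?F g) < k g * t"
            using nb g gens_perm_tuples[OF G \<sigma>] by (auto simp: bad_def not_le)
          also have "\<dots> \<le> K * t" using kK[OF g] by simp
          finally have "real (card (?F g)) \<le> real K * real t"
            by (metis less_imp_le of_nat_le_iff of_nat_mult)
          then show ?thesis using t by linarith
        qed
        then have "(\<Sum>g\<in>?D. real (card (?F g))) \<le> (\<Sum>g\<in>?D. \<delta> * n / (card ?D + 1))"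
          by (rule sum_mono)
        also have "\<dots> = \<delta> * n * (card ?D / (card ?D + 1))" by simp
        also have "\<dots> < \<delta> * n * 1" using \<delta> n by (intro mult_strict_left_mono) auto
        finally show False using sum by simp
      qed
    qed
    moreover have "finite (\<Union>g\<in>?D. bad g)" using fD by (auto simp: bad_def finite_perm_tuples)
    ultimately have "card {\<sigma> \<in> Hom_Sym G n. \<not> sofic G D \<delta> n \<sigma>} \<le> card (\<Union>g\<in>?D. bad g)"
      by (intro card_inj_on_le[of "gens r s"]) (auto intro: inj_on_subset[OF inj_on_gens[OF G]])
    also have "\<dots> \<le> (\<Sum>g\<in>?D. card (bad g))" by (rule card_UN_le) fact
    finally have "card {\<sigma> \<in> Hom_Sym G n. \<not> sofic G D \<delta> n \<sigma>} * fact t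
        \<le> (\<Sum>g\<in>?D. card (bad g) * fact t)"
      by (simp add: sum_distrib_right[symmetric])
    also have "\<dots> \<le> (\<Sum>g\<in>?D. (length (w g))\<^sup>2 * 2 ^ n * fact n ^ r)"
      using card_many_fixed_points[OF w(1) wne] by (intro sum_mono) (simp add: bad_def k_def)
    also have "\<dots> = C * 2 ^ n * fact n ^ r" by (simp add: C_def sum_distrib_right)
    finally show ?thesis by (simp add: t_def)
  qed
  then show thesis using that c by blast
qed

section \<open>The support of the block model is large\<close>

text \<open>The map \<open>\<tau> \<mapsto> f \<circ> \<tau>\<close> takes at most \<open>card A ^ n\<close> values, and each of its fibres is carried
  injectively into the stabiliser of \<open>f\<close> by composing with the inverse of a fixed element.\<close>

lemma card_pattern_stabiliser:
  assumes f: "f \<in> {1..n} \<rightarrow> A" and A: "finite A"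
  shows "fact n \<le> card {\<tau>. \<tau> permutes {1..n} \<and> (\<forall>j\<in>{1..n}. f (\<tau> j) = f j)} * card A ^ n"
proof -
  let ?P = "{\<tau>. \<tau> permutes {1..n}}"
  let ?S = "{\<tau>. \<tau> permutes {1..n} \<and> (\<forall>j\<in>{1..n}. f (\<tau> j) = f j)}"
  define \<Phi> where "\<Phi> \<tau> = (\<lambda>j\<in>{1..n}. f (\<tau> j))" for \<tau>
  have fP: "finite ?P" by (rule finite_permutations) simp
  have fibre: "card {\<tau> \<in> ?P. \<Phi> \<tau> = a} \<le> card ?S" if a: "a \<in> \<Phi> ` ?P" for a
  proof -
    obtain \<tau>0 where \<tau>0: "\<tau>0 permutes {1..n}" "a = \<Phi> \<tau>0" using a by blast
    have inv0: "inv' \<tau>0 permutes {1..n}" using \<tau>0(1) by (rule permutes_inv)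
    show ?thesis
    proof (rule card_inj_on_le[of "\<lambda>\<tau>. \<tau> \<circ> inv' \<tau>0"])
      show "inj_on (\<lambda>\<tau>. \<tau> \<circ> inv' \<tau>0) {\<tau> \<in> ?P. \<Phi> \<tau> = a}"
      proof (rule inj_onI)
        fix \<tau> \<tau>' assume "\<tau> \<circ> inv' \<tau>0 = \<tau>' \<circ> inv' \<tau>0"
        then have "(\<tau> \<circ> inv' \<tau>0) \<circ> \<tau>0 = (\<tau>' \<circ> inv' \<tau>0) \<circ> \<tau>0" by simp
        then show "\<tau> = \<tau>'" by (simp only: comp_assoc permutes_inv_o(2)[OF \<tau>0(1)] comp_id)
      qed
      show "(\<lambda>\<tau>. \<tau> \<circ> inv' \<tau>0) ` {\<tau> \<in> ?P. \<Phi> \<tau> = a} \<subseteq> ?S"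
      proof clarify
        fix \<tau> assume \<tau>: "\<tau> permutes {1..n}" "a = \<Phi> \<tau>"
        have "f (\<tau> (inv' \<tau>0 j)) = f j" if "j \<in> {1..n}" for j
        proof -
          have "inv' \<tau>0 j \<in> {1..n}" using that permutes_in_image[OF inv0] by blast
          moreover have "\<Phi> \<tau> (inv' \<tau>0 j) = \<Phi> \<tau>0 (inv' \<tau>0 j)" using \<tau>(2) \<tau>0(2) by simp
          ultimately have "f (\<tau> (inv' \<tau>0 j)) = f (\<tau>0 (inv' \<tau>0 j))" by (simp add: \<Phi>_def)
          then show ?thesis by (simp add: permutes_inverses[OF \<tau>0(1)])
        qed
        then show "\<tau> \<circ> inv' \<tau>0 permutes {1..n} \<and> (\<forall>j\<in>{1..n}. f ((\<tau> \<circ> inv' \<tau>0) j) = f j)"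
          using permutes_compose[OF inv0 \<tau>(1)] by simp
      qed
      show "finite ?S" using fP by (rule rev_finite_subset) auto
    qed
  qed
  have "fact n = card ?P" by (simp add: card_permutations)
  also have "\<dots> = (\<Sum>a\<in>\<Phi> ` ?P. card {\<tau> \<in> ?P. \<Phi> \<tau> = a})"
    using sum.image_gen[OF fP, of "\<lambda>_. 1::nat" \<Phi>] by simp
  also have "\<dots> \<le> (\<Sum>a\<in>\<Phi> ` ?P. card ?S)" by (intro sum_mono fibre)
  also have "\<dots> = card (\<Phi> ` ?P) * card ?S" by simp
  also have "\<dots> \<le> card ({1..n} \<rightarrow>\<^sub>E A) * card ?S"
  proof (intro mult_right_mono card_mono)
    show "finite ({1..n} \<rightarrow>\<^sub>E A)" using A by (intro finite_PiE) auto
    show "\<Phi> ` ?P \<subseteq> {1..n} \<rightarrow>\<^sub>E A"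
      using f permutes_in_image by (fastforce simp: \<Phi>_def)
  qed simp
  also have "card ({1..n} \<rightarrow>\<^sub>E A) = card A ^ n" by (subst card_PiE) simp_all
  finally show ?thesis by (simp add: mult.commute)
qed

abbreviation edge_window ::
  "('g, 'm) monoid_scheme \<Rightarrow> (nat \<Rightarrow> 'g) \<Rightarrow> nat \<Rightarrow> nat \<Rightarrow> nat \<Rightarrow> 'g set" where
  "edge_window G s r k i \<equiv> word_ball G s r \<one>\<^bsub>G\<^esub> k \<union> word_ball G s r (s i) k"

lemma d_star_empirical_eq_0:
  assumes G: "free_group G s r" and y: "y \<in> {1..n} \<rightarrow> B"
    and \<sigma>: "\<sigma> \<in> Hom_Sym G n" "\<sigma>0 \<in> Hom_Sym G n"
    and eq: "\<And>i g j. i \<in> {1..r} \<Longrightarrow> g \<in> edge_window G s r k i \<Longrightarrow> j \<in> {1..n} \<Longrightarrow>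
      y (\<sigma> g j) = y (\<sigma>0 g j)"
  shows "d_star G s r B k (empirical_law G B n \<sigma> y) (empirical_law G B n \<sigma>0 y) = 0"
proof -
  interpret group G using G by (simp add: free_group_def)
  have meas: "(\<lambda>j. \<lambda>g\<in>carrier G. y (\<sigma> g j))
      \<in> uniform_count_measure {1..n} \<rightarrow>\<^sub>M config_space (carrier G) B"
    if \<sigma>: "\<sigma> \<in> Hom_Sym G n" for \<sigma>
  proof -
    have "y (\<sigma> g j) \<in> B" if "g \<in> carrier G" "j \<in> {1..n}" for g j
      using y that permutes_in_image[OF Hom_Sym_simps(2)[OF \<sigma> that(1) that(1)], of j] by auto
    then show ?thesis
      by (auto simp: measurable_def config_space_def space_PiM sets_uniform_count_measure
          space_uniform_count_measure)
  qed
  have "marginal_tv B (edge_window G s r k i) (empirical_law G B n \<sigma> y)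
      (empirical_law G B n \<sigma>0 y) = 0" if i: "i \<in> {1..r}" for i
  proof -
    let ?H = "edge_window G s r k i"
    have H: "?H \<subseteq> carrier G"
      using word_ball_subset[OF G] free_group_s_closed[OF G i] by auto
    have marg: "marginal B ?H (empirical_law G B n \<sigma> y) =
        distr (uniform_count_measure {1..n}) (config_space ?H B) (\<lambda>j. \<lambda>g\<in>?H. y (\<sigma> g j))"
      if "\<sigma> \<in> Hom_Sym G n" for \<sigma>
    proof -
      have "(\<lambda>z. restrict z ?H) \<in> config_space (carrier G) B \<rightarrow>\<^sub>M config_space ?H B"
        unfolding config_space_def by (rule measurable_restrict_subset[OF H])
      then show ?thesis
        unfolding marginal_def empirical_law_def
        using H by (subst distr_distr[OF _ meas[OF that]])
          (auto simp: o_def Int_absorb1 intro!: distr_cong)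
    qed
    have "marginal B ?H (empirical_law G B n \<sigma> y) = marginal B ?H (empirical_law G B n \<sigma>0 y)"
      unfolding marg[OF \<sigma>(1)] marg[OF \<sigma>(2)]
      by (rule distr_cong) (auto simp: space_uniform_count_measure eq[OF i])
    then show ?thesis by (simp add: marginal_tv_def)
  qed
  then show ?thesis by (simp add: d_star_def)
qed

text \<open>For \<open>g \<in> B(e,k)\<close> the proof is by induction on a word for \<open>g\<close>, peeling off the letter that acts
  first. A letter \<open>s i\<close> acts under \<open>\<sigma>\<close> as under \<open>\<sigma>0\<close> after \<open>\<tau> i\<close>, and \<open>\<tau> i\<close> preserves the
  \<open>\<sigma>0\<close>-pattern on \<open>B(e,k)\<close>. An inverse letter acts as under \<open>\<sigma>0\<close> but followed by the inverse of
  \<open>\<tau> i\<close>, which preserves it too. Points of \<open>B(s i,k)\<close> then need one more step along \<open>s i\<close>, for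
  which \<open>\<tau> i\<close> has to preserve the pattern on \<open>B(s i,k)\<close> as well.\<close>

lemma pattern_invariant:
  assumes G: "free_group G s r" and \<sigma>: "\<sigma> \<in> Hom_Sym G n" "\<sigma>0 \<in> Hom_Sym G n"
    and \<tau>: "\<And>i. i \<in> {1..r} \<Longrightarrow> \<tau> i permutes {1..n}"
    and pat: "\<And>i g j. i \<in> {1..r} \<Longrightarrow> g \<in> edge_window G s r k i \<Longrightarrow> j \<in> {1..n} \<Longrightarrow>
      y (\<sigma>0 g (\<tau> i j)) = y (\<sigma>0 g j)"
    and gen: "\<And>i. i \<in> {1..r} \<Longrightarrow> \<sigma> (s i) = \<sigma>0 (s i) \<circ> \<tau> i"
    and i: "i \<in> {1..r}" and g: "g \<in> edge_window G s r k i" and j: "j \<in> {1..n}"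
  shows "y (\<sigma> g j) = y (\<sigma>0 g j)"
proof -
  interpret group G using G by (simp add: free_group_def)
  have ball_1: "word_val G s w \<in> word_ball G s r \<one>\<^bsub>G\<^esub> k" if "w \<in> words r" "length w \<le> k" for w
    unfolding word_ball_eq[OF G]
    using that free_group_word_val[OF G that(1)] by (auto intro!: image_eqI[of _ _ w])
  have ball: "y (\<sigma> (word_val G s w) j) = y (\<sigma>0 (word_val G s w) j)"
    if "w \<in> words r" "length w \<le> k" "j \<in> {1..n}" for w j
    using that
  proof (induction w arbitrary: j rule: rev_induct)
    case Nil
    then show ?case by (simp add: Hom_Sym_word_val[OF G \<sigma>(1), of "[]", simplified]
          Hom_Sym_word_val[OF G \<sigma>(2), of "[]", simplified])
  next
    case (snoc l w)
    obtain i a where l: "l = (i, a)" by (cases l)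
    have w: "w \<in> words r" "length w \<le> k" and i: "i \<in> {1..r}" and lr: "fst l \<in> {1..r}"
      using snoc.prems l by auto
    have wc: "word_val G s w \<in> carrier G" using free_group_word_val[OF G w(1)] .
    have lc: "letter_val G s l \<in> carrier G" using letter_val_closed[OF G lr] .
    have si: "s i \<in> carrier G" using free_group_s_closed[OF G i] .
    have val: "word_val G s (w @ [l]) = word_val G s w \<otimes>\<^bsub>G\<^esub> letter_val G s l"
      using word_val_append[OF G w(1), of "[l]"] lr lc by simp
    have split: "\<rho> (word_val G s (w @ [l])) x = \<rho> (word_val G s w) (\<rho> (letter_val G s l) x)"
      if "\<rho> \<in> Hom_Sym G n" for \<rho> x
      using Hom_Sym_simps(1)[OF that wc lc] by (simp add: val)
    have "\<sigma> (letter_val G s l) j \<in> {1..n}"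
      using permutes_in_image[OF Hom_Sym_simps(2)[OF \<sigma>(1) lc lc]] snoc.prems(3) by blast
    from snoc.IH[OF w this]
    have IH: "y (\<sigma> (word_val G s (w @ [l])) j) =
        y (\<sigma>0 (word_val G s w) (\<sigma> (letter_val G s l) j))"
      by (simp only: split[OF \<sigma>(1)])
    have act: "\<rho> (letter_val G s l) = (if a then \<rho> (s i) else inv' (\<rho> (s i)))"
      if "\<rho> \<in> Hom_Sym G n" for \<rho>
      using Hom_Sym_letter_val[OF G that lr] i by (simp add: letter_act_def gens_def l)
    show ?case
    proof (cases a)
      case True
      have "\<sigma> (letter_val G s l) j = \<sigma>0 (letter_val G s l) (\<tau> i j)"
        by (simp add: act[OF \<sigma>(1)] act[OF \<sigma>(2)] True gen[OF i])
      then have "y (\<sigma> (word_val G s (w @ [l])) j) = y (\<sigma>0 (word_val G s (w @ [l])) (\<tau> i j))"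
        using IH by (simp only: split[OF \<sigma>(2)])
      also have "\<dots> = y (\<sigma>0 (word_val G s (w @ [l])) j)"
        using pat[OF i] ball_1[OF snoc.prems(1,2)] snoc.prems(3) by blast
      finally show ?thesis .
    next
      case False
      define j' where "j' = inv' (\<sigma>0 (s i)) j"
      note \<sigma>0i = Hom_Sym_simps(2)[OF \<sigma>(2) si si]
      have j': "j' \<in> {1..n}"
        using permutes_in_image[OF permutes_inv[OF \<sigma>0i]] snoc.prems(3) by (simp only: j'_def)
      have \<tau>j': "inv' (\<tau> i) j' \<in> {1..n}"
        using permutes_in_image[OF permutes_inv[OF \<tau>[OF i]]] j' by blast
      have "\<sigma> (letter_val G s l) j = inv' (\<tau> i) j'"
        by (simp add: act[OF \<sigma>(1)] False gen[OF i] j'_def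
            o_inv_distrib[OF permutes_bij[OF \<sigma>0i] permutes_bij[OF \<tau>[OF i]]])
      then have "y (\<sigma> (word_val G s (w @ [l])) j) = y (\<sigma>0 (word_val G s w) (inv' (\<tau> i) j'))"
        using IH by simp
      also have "\<dots> = y (\<sigma>0 (word_val G s w) (\<tau> i (inv' (\<tau> i) j')))"
        using pat[OF i _ \<tau>j'] ball_1[OF w] by simp
      also have "\<dots> = y (\<sigma>0 (word_val G s w) j')" by (simp add: permutes_inverses[OF \<tau>[OF i]])
      also have "\<dots> = y (\<sigma>0 (word_val G s (w @ [l])) j)"
        by (simp add: split[OF \<sigma>(2)] act[OF \<sigma>(2)] False j'_def)
      finally show ?thesis .
    qed
  qed
  have si: "s i \<in> carrier G" using free_group_s_closed[OF G i] .
  consider w where "w \<in> words r" "length w \<le> k" "g = word_val G s w"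
    | w where "w \<in> words r" "length w \<le> k" "g = word_val G s w \<otimes>\<^bsub>G\<^esub> s i"
    using g free_group_word_val[OF G] by (auto simp: word_ball_eq[OF G])
  then show ?thesis
  proof cases
    case 1
    then show ?thesis using ball j by simp
  next
    case 2
    note wc = free_group_word_val[OF G 2(1)]
    have "\<sigma> (s i) j \<in> {1..n}"
      using permutes_in_image[OF Hom_Sym_simps(2)[OF \<sigma>(1) si si]] j by blast
    then have "y (\<sigma> g j) = y (\<sigma>0 (word_val G s w) (\<sigma> (s i) j))"
      using ball[OF 2(1,2)] by (simp add: 2(3) Hom_Sym_simps(1)[OF \<sigma>(1) wc si])
    also have "\<dots> = y (\<sigma>0 g (\<tau> i j))"
      by (simp add: gen[OF i] 2(3) Hom_Sym_simps(1)[OF \<sigma>(2) wc si])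
    also have "\<dots> = y (\<sigma>0 g j)" by (rule pat[OF i g j])
    finally show ?thesis .
  qed
qed

text \<open>A window has at most \<open>2 * (2 * r + 1) ^ k\<close> elements, so the exponent of \<open>card B\<close> accounts for the
  \<open>r\<close> pigeonhole arguments, one for each generator.\<close>

lemma card_SBM_support:
  assumes G: "free_group G s r" and B: "finite B" "B \<noteq> {}"
    and y: "y \<in> {1..n} \<rightarrow> B" and \<sigma>0: "\<sigma>0 \<in> Hom_Sym G n"
  shows "fact n ^ r \<le> card (SBM_support G s r B n \<sigma>0 y k) *
    card B ^ (2 * (2 * r + 1) ^ k * n * r)"
proof -
  interpret group G using G by (simp add: free_group_def)
  let ?H = "edge_window G s r k"
  let ?S = "SBM_support G s r B n \<sigma>0 y k"
  let ?N = "card B ^ (2 * (2 * r + 1) ^ k * n)"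
  define Stab where "Stab i =
    {\<tau>. \<tau> permutes {1..n} \<and> (\<forall>j\<in>{1..n}. \<forall>g\<in>?H i. y (\<sigma>0 g (\<tau> j)) = y (\<sigma>0 g j))}" for i
  have stab: "fact n \<le> card (Stab i) * ?N" if i: "i \<in> {1..r}" for i
  proof -
    have fH: "finite (?H i)" using card_word_ball(1)[OF G] by simp
    have cH: "card (?H i) \<le> 2 * (2 * r + 1) ^ k"
      using card_Un_le[of "word_ball G s r \<one>\<^bsub>G\<^esub> k" "word_ball G s r (s i) k"]
        card_word_ball(2)[OF G, of "\<one>\<^bsub>G\<^esub>" k] card_word_ball(2)[OF G, of "s i" k] by linarith
    have H: "?H i \<subseteq> carrier G"
      using word_ball_subset[OF G] free_group_s_closed[OF G i] by auto
    let ?f = "\<lambda>j. \<lambda>g\<in>?H i. y (\<sigma>0 g j)"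
    have "?f \<in> {1..n} \<rightarrow> (?H i \<rightarrow>\<^sub>E B)"
    proof (intro funcsetI PiE_I)
      fix j g assume "j \<in> {1..n}" "g \<in> ?H i"
      then have "\<sigma>0 g j \<in> {1..n}"
        using permutes_in_image[OF Hom_Sym_simps(2)[OF \<sigma>0]] H by blast
      then show "?f j g \<in> B" using y \<open>g \<in> ?H i\<close> by auto
    qed simp
    moreover have "finite (?H i \<rightarrow>\<^sub>E B)" using fH B by (intro finite_PiE) auto
    ultimately have "fact n \<le> card {\<tau>. \<tau> permutes {1..n} \<and> (\<forall>j\<in>{1..n}. ?f (\<tau> j) = ?f j)}
        * card (?H i \<rightarrow>\<^sub>E B) ^ n" by (rule card_pattern_stabiliser)
    also have "{\<tau>. \<tau> permutes {1..n} \<and> (\<forall>j\<in>{1..n}. ?f (\<tau> j) = ?f j)} = Stab i"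
      unfolding Stab_def by (auto simp: fun_eq_iff restrict_def split: if_splits)
    also have "card (?H i \<rightarrow>\<^sub>E B) ^ n = card B ^ (card (?H i) * n)"
      using fH by (simp add: card_PiE power_mult)
    also have "card (Stab i) * card B ^ (card (?H i) * n) \<le> card (Stab i) * ?N"
      using cH B by (intro mult_left_mono power_increasing mult_right_mono)
        (auto simp: Suc_le_eq card_gt_0_iff)
    finally show ?thesis .
  qed
  have finS: "finite ?S" using finite_Hom_Sym[OF G] by (simp add: SBM_support_def)
  let ?gen = "\<lambda>\<tau>. \<lambda>i\<in>{1..r}. \<sigma>0 (s i) \<circ> \<tau> i"
  have \<sigma>0_perm: "\<sigma>0 (s i) permutes {1..n}" if "i \<in> {1..r}" for i
    using Hom_Sym_simps(2)[OF \<sigma>0] free_group_s_closed[OF G that] by blast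
  have ex: "\<exists>\<sigma>\<in>?S. gens r s \<sigma> = ?gen \<tau>" if \<tau>: "\<tau> \<in> Pi\<^sub>E {1..r} Stab" for \<tau>
  proof -
    have \<tau>_perm: "\<tau> i permutes {1..n}" if "i \<in> {1..r}" for i
      using PiE_mem[OF \<tau> that] by (simp add: Stab_def)
    have "?gen \<tau> \<in> perm_tuples r n"
      unfolding perm_tuples_def using \<sigma>0_perm \<tau>_perm by (auto intro: permutes_compose)
    from Hom_Sym_extend[OF G this] obtain \<sigma> where
      \<sigma>: "\<sigma> \<in> Hom_Sym G n" "gens r s \<sigma> = ?gen \<tau>" by blast
    have gen: "\<sigma> (s i) = \<sigma>0 (s i) \<circ> \<tau> i" if "i \<in> {1..r}" for i
      using fun_cong[OF \<sigma>(2), of i] that by (simp add: gens_def)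
    have "d_star G s r B k (empirical_law G B n \<sigma> y) (empirical_law G B n \<sigma>0 y) = 0"
    proof (rule d_star_empirical_eq_0[OF G y \<sigma>(1) \<sigma>0])
      fix i g j assume h: "i \<in> {1..r}" "g \<in> ?H i" "j \<in> {1..n}"
      show "y (\<sigma> g j) = y (\<sigma>0 g j)"
      proof (rule pattern_invariant[OF G \<sigma>(1) \<sigma>0 \<tau>_perm _ gen h])
        fix i g j assume "i \<in> {1..r}" "g \<in> ?H i" "j \<in> {1..n}"
        then show "y (\<sigma>0 g (\<tau> i j)) = y (\<sigma>0 g j)"
          using PiE_mem[OF \<tau>, of i] unfolding Stab_def by blast
      qed
    qed
    then show ?thesis using \<sigma> by (auto simp: SBM_support_def)
  qed
  have "inj_on ?gen (Pi\<^sub>E {1..r} Stab)"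
  proof (rule inj_onI)
    fix \<tau> \<tau>' assume \<tau>: "\<tau> \<in> Pi\<^sub>E {1..r} Stab" "\<tau>' \<in> Pi\<^sub>E {1..r} Stab" and eq: "?gen \<tau> = ?gen \<tau>'"
    show "\<tau> = \<tau>'"
    proof (rule PiE_ext[OF \<tau>])
      fix i assume i: "i \<in> {1..r}"
      then have "\<sigma>0 (s i) \<circ> \<tau> i = \<sigma>0 (s i) \<circ> \<tau>' i" using fun_cong[OF eq, of i] by simp
      then show "\<tau> i = \<tau>' i"
        using permutes_inj[OF \<sigma>0_perm[OF i]] by (auto simp: fun_eq_iff inj_eq)
    qed
  qed
  moreover have "?gen ` Pi\<^sub>E {1..r} Stab \<subseteq> gens r s ` ?S"
  proof
    fix p assume "p \<in> ?gen ` Pi\<^sub>E {1..r} Stab"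
    then obtain \<tau> where "\<tau> \<in> Pi\<^sub>E {1..r} Stab" "p = ?gen \<tau>" by blast
    then show "p \<in> gens r s ` ?S" using ex[of \<tau>] by force
  qed
  ultimately have "card (Pi\<^sub>E {1..r} Stab) \<le> card (gens r s ` ?S)"
    using finS by (intro card_inj_on_le) auto
  then have le: "(\<Prod>i\<in>{1..r}. card (Stab i)) \<le> card ?S"
    using card_image_le[OF finS, of "gens r s"] by (simp add: card_PiE)
  have "fact n ^ r = (\<Prod>i\<in>{1..r}. fact n)" by simp
  also have "\<dots> \<le> (\<Prod>i\<in>{1..r}. card (Stab i) * ?N)" by (intro prod_mono conjI stab) simp_all
  also have "\<dots> = (\<Prod>i\<in>{1..r}. card (Stab i)) * ?N ^ r" by (simp add: prod.distrib)
  also have "\<dots> \<le> card ?S * ?N ^ r" using le by (rule mult_right_mono) simp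
  finally show ?thesis by (simp add: power_mult)
qed

section \<open>Asymptotic estimates\<close>

text \<open>Comparison of \<open>exp t\<close> with the single term \<open>t^t / t!\<close> of its series.\<close>

lemma ln_fact_lower: "real t * (ln (real t) - 1) \<le> ln (fact t)"
proof (cases "t = 0")
  case False
  have "(\<lambda>k. real t ^ k /\<^sub>R fact k) sums exp (real t)" by (rule exp_converges)
  then have "real t ^ t / fact t \<le> exp (real t)"
    using sum_le_suminf[of "\<lambda>k. real t ^ k /\<^sub>R fact k" "{t}"]
    by (simp add: sums_iff divide_inverse mult.commute)
  then have "real t ^ t \<le> fact t * exp (real t)" by (simp add: field_simps)
  then have "ln (real t ^ t) \<le> ln (fact t * exp (real t))"
    using False by (subst ln_le_cancel_iff) auto
  then show ?thesis using False by (simp add: ln_mult ln_realpow algebra_simps)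
qed simp

text \<open>With \<open>t = \<lfloor>c n\<rfloor>\<close>, \<open>ln (t!)\<close> eventually exceeds \<open>c' n ln n\<close> for every \<open>c' < c\<close>,
  and the positive terms are \<open>o(n ln n)\<close>. The proof gets \<open>c / 2\<close> from the crude bound
  \<open>c n / 2 \<le> t\<close>, and the margin down to \<open>c / 4\<close> absorbs the positive terms.\<close>

lemma dominated_by_power_rate:
  fixes c a b :: real
  assumes c: "c > 0"
  shows "\<forall>\<^sub>F n::nat in sequentially.
    a + n * ln 2 + b * n * sqrt (ln n) - ln (fact (nat \<lfloor>c * n\<rfloor>)) \<le> - (c / 4 * n) * ln n"
proof -
  have 1: "\<forall>\<^sub>F n::nat in sequentially. c * n / 2 \<ge> exp 1"
    using c by real_asymp
  have 2: "\<forall>\<^sub>F n::nat in sequentially.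
    a + n * ln 2 + b * n * sqrt (ln n) + c / 4 * n * ln n \<le> c * n / 2 * (ln (c * n / 2) - 1)"
    using c by real_asymp
  from 1 2 show ?thesis
  proof eventually_elim
    case (elim n)
    define t where "t = nat \<lfloor>c * n\<rfloor>"
    have e: "exp 1 \<ge> (1::real)" by simp
    have "c * n - 1 \<le> real t" unfolding t_def using c by linarith
    then have t: "c * n / 2 \<le> real t" using elim(1) e by linarith
    have pos: "0 < c * n / 2" using elim(1) e by linarith
    have ln1: "1 \<le> ln (c * n / 2)" using elim(1) pos by (simp add: ln_ge_iff)
    have "c * n / 2 * (ln (c * n / 2) - 1) \<le> real t * (ln (real t) - 1)"
      using t pos ln1 by (intro mult_mono diff_right_mono) (auto simp: ln_le_cancel_iff)
    also have "\<dots> \<le> ln (fact t)" by (rule ln_fact_lower)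
    finally show ?case using elim(2) by (simp add: t_def)
  qed
qed

lemma power_growth_le_sqrt_ln:
  fixes m :: "nat \<Rightarrow> nat"
  assumes "a > (1::real)" and m: "(\<lambda>n. real (m n)) \<in> o(\<lambda>n. ln (ln (real n)))"
  shows "\<forall>\<^sub>F n in sequentially. a ^ m n \<le> sqrt (ln n)"
proof -
  have la: "ln a > 0" using assms(1) by simp
  have "\<forall>\<^sub>F n in sequentially. norm (real (m n)) \<le> 1 / (2 * ln a) * norm (ln (ln (real n)))"
    using la by (intro landau_o.smallD[OF m]) simp
  moreover have "\<forall>\<^sub>F n::nat in sequentially. ln (real n) \<ge> 1" by real_asymp
  ultimately show ?thesis
  proof eventually_elim
    case (elim n)
    have "ln (ln (real n)) \<ge> 0" using elim(2) by (rule ln_ge_zero)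
    then have "real (m n) \<le> 1 / (2 * ln a) * ln (ln (real n))" using elim(1) by simp
    then have le: "real (m n) * ln a \<le> ln (ln (real n)) / 2" using la by (simp add: field_simps)
    have "a ^ m n = exp (real (m n) * ln a)"
      using assms(1) by (simp add: exp_of_nat_mult)
    also have "\<dots> \<le> exp (ln (ln (real n)) / 2)" using le by simp
    also have "\<dots> = sqrt (ln n)"
      using elim(2) by (simp add: powr_def powr_half_sqrt[symmetric])
    finally show ?case .
  qed
qed

section \<open>Soficity of the block model\<close>

text \<open>The quotient of the count of non-sofic homomorphisms by that of the support; the factor
  \<open>fact n ^ r\<close> common to both cancels.\<close>

lemma prob_not_sofic_SBM:
  assumes G: "free_group G s r" and B: "finite B" "B \<noteq> {}"
    and y: "y \<in> {1..n} \<rightarrow> B" and \<sigma>0: "\<sigma>0 \<in> Hom_Sym G n"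
    and bound: "card {\<sigma> \<in> Hom_Sym G n. \<not> sofic G D \<delta> n \<sigma>} * fact t \<le> C * 2 ^ n * fact n ^ r"
  shows "measure_pmf.prob (SBM G s r B n \<sigma>0 y k) {\<tau>. \<not> sofic G D \<delta> n \<tau>}
    \<le> real C * 2 ^ n * real (card B) ^ (2 * (2 * r + 1) ^ k * n * r) / fact t"
proof -
  let ?S = "SBM_support G s r B n \<sigma>0 y k"
  let ?X = "card {\<sigma> \<in> Hom_Sym G n. \<not> sofic G D \<delta> n \<sigma>}"
  let ?N = "card B ^ (2 * (2 * r + 1) ^ k * n * r)"
  have fH: "finite (Hom_Sym G n)" by (rule finite_Hom_Sym[OF G])
  have fS: "finite ?S" using fH by (simp add: SBM_support_def)
  have "\<sigma>0 \<in> ?S" using \<sigma>0 by (simp add: SBM_support_def d_star_def marginal_tv_def)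
  then have nS: "?S \<noteq> {}" by blast
  then have posS: "0 < card ?S" using fS by (simp add: card_gt_0_iff)
  have "card (?S \<inter> {\<tau>. \<not> sofic G D \<delta> n \<tau>}) \<le> ?X"
    using fH by (intro card_mono) (auto simp: SBM_support_def)
  then have "card (?S \<inter> {\<tau>. \<not> sofic G D \<delta> n \<tau>}) * fact t \<le> ?X * fact t"
    by (rule mult_right_mono) simp
  also have "\<dots> \<le> C * 2 ^ n * fact n ^ r" by (rule bound)
  also have "\<dots> \<le> C * 2 ^ n * (card ?S * ?N)"
    using card_SBM_support[OF G B y \<sigma>0] by (rule mult_left_mono) simp
  finally have "real (card (?S \<inter> {\<tau>. \<not> sofic G D \<delta> n \<tau>}) * fact t)
      \<le> real (C * 2 ^ n * (card ?S * ?N))" by (simp only: of_nat_le_iff)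
  then have "real (card (?S \<inter> {\<tau>. \<not> sofic G D \<delta> n \<tau>})) * fact t
      \<le> (real C * 2 ^ n * real (card B) ^ (2 * (2 * r + 1) ^ k * n * r)) * real (card ?S)"
    by (simp add: mult_ac)
  moreover have "measure_pmf.prob (SBM G s r B n \<sigma>0 y k) {\<tau>. \<not> sofic G D \<delta> n \<tau>}
      = real (card (?S \<inter> {\<tau>. \<not> sofic G D \<delta> n \<tau>})) / real (card ?S)"
    unfolding SBM_def by (rule measure_pmf_of_set[OF nS fS])
  moreover have "(0::real) < fact t" by simp
  ultimately show ?thesis using posS by (simp add: divide_le_eq le_divide_eq mult_ac)
qed

theorem proposition1p1:
  fixes G :: "('g, 'm) monoid_scheme" and s :: "nat \<Rightarrow> 'g" and r :: nat
    and M :: "'x measure" and T :: "'g \<Rightarrow> 'x \<Rightarrow> 'x"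
    and B :: "'b set" and \<beta> :: "'x \<Rightarrow> 'b"
    and y :: "nat \<Rightarrow> nat \<Rightarrow> 'b" and \<sigma> :: "nat \<Rightarrow> 'g \<Rightarrow> nat \<Rightarrow> nat"
    and \<mu> :: "nat \<Rightarrow> ('g \<Rightarrow> nat \<Rightarrow> nat) pmf"
    and D :: "'g set" and \<delta> :: real
  assumes "free_group G s r" and "r \<ge> 1"
    and "standard_prob_space M" and "T \<in> hom G (mp_aut_group M)"
    and "finite B" and "\<beta> \<in> M \<rightarrow>\<^sub>M count_space B"
    and "\<And>n. y n \<in> {1..n} \<rightarrow> B" and "\<And>n. \<sigma> n \<in> Hom_Sym G n"
    and "(markov_measure G s r B (obs_law G M T B \<beta>) \<and>
          (\<lambda>n. d_star G s r B 0 (empirical_law G B n (\<sigma> n) (y n)) (obs_law G M T B \<beta>))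
            \<longlonglongrightarrow> 0 \<and>
          (\<forall>n. \<mu> n = SBM G s r B n (\<sigma> n) (y n) 0))
       \<or> (f_invariant G s r M T B \<beta> > -\<infinity> \<and>
          (\<exists>m :: nat \<Rightarrow> nat.
            filterlim m at_top sequentially \<and>
            (\<lambda>n. real (m n)) \<in> o(\<lambda>n. ln (ln (real n))) \<and>
            (\<lambda>n. d_star G s r B (m n) (empirical_law G B n (\<sigma> n) (y n)) (obs_law G M T B \<beta>))
              \<in> O(\<lambda>n. 1 / ln (real n)) \<and>
            (\<forall>n. \<mu> n = SBM G s r B n (\<sigma> n) (y n) (m n))))"
    and "finite D" and "D \<subseteq> carrier G" and "\<delta> > 0"
  shows "\<exists>\<epsilon>>0. \<forall>\<^sub>F n in sequentially.
    measure_pmf.prob (\<mu> n) {\<tau>. sofic G D \<delta> n \<tau>} \<ge> 1 - real n powr (- (\<epsilon> * real n))"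
proof -
  note G = assms(1) and r = assms(2) and B = assms(5) and y = assms(7) and \<sigma> = assms(8)
  \<comment> \<open>Both alternatives are block models of a depth \<open>m n\<close> for which balls of radius \<open>m n\<close>
    eventually have at most \<open>sqrt (ln n)\<close> elements.\<close>
  obtain m where \<mu>: "\<And>n. \<mu> n = SBM G s r B n (\<sigma> n) (y n) (m n)"
    and growth: "\<forall>\<^sub>F n in sequentially. real (2 * r + 1) ^ m n \<le> sqrt (ln (real n))"
    using assms(9)
  proof (elim disjE conjE exE)
    assume \<mu>: "\<forall>n. \<mu> n = SBM G s r B n (\<sigma> n) (y n) 0"
    have "\<forall>\<^sub>F n::nat in sequentially. 1 \<le> sqrt (ln (real n))" by real_asymp
    then show thesis using that[of "\<lambda>_. 0"] \<mu> by simp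
  next
    fix m :: "nat \<Rightarrow> nat"
    assume m: "(\<lambda>n. real (m n)) \<in> o(\<lambda>n. ln (ln (real n)))"
      and \<mu>: "\<forall>n. \<mu> n = SBM G s r B n (\<sigma> n) (y n) (m n)"
    have "real (2 * r + 1) > 1" using r by simp
    from power_growth_le_sqrt_ln[OF this m] show thesis using that[of m] \<mu> by simp
  qed
  obtain c :: real and C where c: "c > 0" and C: "\<And>n. n > 0 \<Longrightarrow>
      card {\<sigma> \<in> Hom_Sym G n. \<not> sofic G D \<delta> n \<sigma>} * fact (nat \<lfloor>c * n\<rfloor>) \<le> C * 2 ^ n * fact n ^ r"
    using card_not_sofic[OF G assms(10-12)] by blast
  have "y 1 1 \<in> B" using y[of 1] by auto
  then have Bne: "B \<noteq> {}" by blast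
  then have b: "1 \<le> real (card B)" using B by (simp add: Suc_le_eq card_gt_0_iff)
  let ?b = "2 * real r * ln (real (card B))"
  have "\<forall>\<^sub>F n::nat in sequentially. n > 0" by (rule eventually_gt_at_top)
  moreover note growth
  moreover have "\<forall>\<^sub>F n::nat in sequentially. ln (real (C + 1)) + n * ln 2 + ?b * n * sqrt (ln n)
      - ln (fact (nat \<lfloor>c * n\<rfloor>)) \<le> - (c / 4 * n) * ln n"
    by (rule dominated_by_power_rate[OF c])
  ultimately have "\<forall>\<^sub>F n in sequentially. measure_pmf.prob (\<mu> n) {\<tau>. sofic G D \<delta> n \<tau>}
      \<ge> 1 - real n powr (- (c / 4 * real n))"
  proof eventually_elim
    case (elim n)
    let ?t = "nat \<lfloor>c * n\<rfloor>" and ?L = "(2 * r + 1) ^ m n"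
    let ?Q = "real (C + 1) * 2 ^ n * real (card B) ^ (2 * ?L * n * r) / fact ?t"
    have b0: "0 < real (card B)" using b by linarith
    have "card {\<sigma> \<in> Hom_Sym G n. \<not> sofic G D \<delta> n \<sigma>} * fact ?t \<le> (C + 1) * 2 ^ n * fact n ^ r"
      using C[OF elim(1)] by (simp add: add_mult_distrib)
    from prob_not_sofic_SBM[OF G B Bne y \<sigma> this]
    have le: "measure_pmf.prob (\<mu> n) {\<tau>. \<not> sofic G D \<delta> n \<tau>} \<le> ?Q"
      unfolding \<mu> .
    have Q: "?Q > 0" using b0 by (intro divide_pos_pos mult_pos_pos zero_less_power) simp_all
    have "ln ?Q = ln (real (C + 1)) + n * ln 2 + real (2 * ?L * n * r) * ln (real (card B))
        - ln (fact ?t)"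
      using b0 by (simp add: ln_div ln_mult ln_realpow del: of_nat_add of_nat_mult of_nat_power)
    also have "real (2 * ?L * n * r) * ln (real (card B)) = ?b * n * real (2 * r + 1) ^ m n"
      by (simp add: mult_ac)
    also have "?b * n * real (2 * r + 1) ^ m n \<le> ?b * n * sqrt (ln n)"
      using elim(2) b by (intro mult_left_mono) auto
    finally have "ln ?Q \<le> - (c / 4 * n) * ln n" using elim(3) by linarith
    then have "exp (ln ?Q) \<le> exp (- (c / 4 * n) * ln n)" by (simp only: exp_le_cancel_iff)
    then have "?Q \<le> exp (- (c / 4 * n) * ln n)" using Q by (simp only: exp_ln)
    also have "\<dots> = real n powr (- (c / 4 * real n))" using elim(1) by (simp add: powr_def)
    finally have "measure_pmf.prob (\<mu> n) {\<tau>. \<not> sofic G D \<delta> n \<tau>} \<le> real n powr (- (c / 4 * real n))"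
      using le by linarith
    moreover have "measure_pmf.prob (\<mu> n) {\<tau>. \<not> sofic G D \<delta> n \<tau>}
        = 1 - measure_pmf.prob (\<mu> n) {\<tau>. sofic G D \<delta> n \<tau>}"
      using measure_pmf.prob_compl[of "{\<tau>. sofic G D \<delta> n \<tau>}" "\<mu> n"]
      by (simp add: Compl_eq_Diff_UNIV[symmetric] Collect_neg_eq[symmetric])
    ultimately show ?case by linarith
  qed
  then show ?thesis using c by (intro exI[of _ "c / 4"]) simp
qed

end
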